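(* Let $\alpha,\beta\in[0,2\pi)$, $s=\sin(\alpha+\beta)$, $r=\sin(\alpha-\beta)$, and assume $0<|r|<1$ and $s\neq0$. Let $\psi_n=U^{2n}\delta_{((0,0);1)}$ and, for $j\in\mathbb{Z}_+$, $m\in\mathbb{Z}$, $$\nu_n(2j,m)=|\psi_n((j,m);1)|^2,\qquad \nu_n(2j+1,m)=|\psi_n((j,m);0)|^2.$$ Define $g:\mathbb{Z}_+\times\mathbb{R}\to\mathbb{R}_+$ by $$g(2j,y)=\frac{2s^2}{r^2}y^2f_K(y;|r|)\,\zeta(y)^{j}\,\chi(y),\qquad g(2j+1,y)=\frac{2s^2}{r^2}y^2f_K(y;|r|)\,\zeta(y)^{j+1}\,\chi(y),$$ where $\zeta(y)=\dfrac{|r|-|s||y|}{|r|+|s||y|}$, and $\chi=\mathbf{1}_{[0,\infty)}$ if $sr>0$, $\chi=\mathbf{1}_{(-\infty,0]}$ if $sr<0$. Then for every $j\in\mathbb{Z}_+$ and all real $a<b$, $$\lim_{n\to\infty}\sum_{m:\,a<m/n<b}\nu_n(j,m)=\int_a^b g(j,y)\,dy.$$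
   Context: Quantum walk: $\mathbb{Z}_+=\{0,1,2,\dots\}$, $V=\mathbb{Z}_+\times\mathbb{Z}$, $\partial V=\{(0,j):j\in\mathbb{Z}\}$, and $A=\{(\boldsymbol{x};d):\boldsymbol{x}\in V,\ d\in\{0,1,2,3\}\}$ is the arc set: $(\boldsymbol{x};d)$ is the arc with terminus $\boldsymbol{x}$ and origin $\boldsymbol{x}+(1,0)$ if $d=0$; $\boldsymbol{x}-(1,0)$ if $d=1$, $\boldsymbol{x}\notin\partial V$; $\boldsymbol{x}$ if $d=1$, $\boldsymbol{x}\in\partial V$ (a self-loop); $\boldsymbol{x}+(0,1)$ if $d=2$; $\boldsymbol{x}-(0,1)$ if $d=3$. The inverse arc $\bar a$ of $a$ exchanges origin and terminus: $(\boldsymbol{x};0)$ and $(\boldsymbol{x}+(1,0);1)$ are mutually inverse, $(\boldsymbol{x};2)$ and $(\boldsymbol{x}+(0,1);3)$ are mutually inverse, and each self-loop is its own inverse. $\delta_a\in\ell^2(A)$ is the Kronecker delta. The coin $C$ is the unitary on $\ell^2(A)$ with, for each $\boldsymbol{x}\in V$, $C\delta_{(\boldsymbol{x};0)}=\cos\beta\,\delta_{(\boldsymbol{x};3)}+\sin\beta\,\delta_{(\boldsymbol{x};2)}$, $C\delta_{(\boldsymbol{x};1)}=-\sin\beta\,\delta_{(\boldsymbol{x};3)}+\cos\beta\,\delta_{(\boldsymbol{x};2)}$, $C\delta_{(\boldsymbol{x};2)}=\cos\alpha\,\delta_{(\boldsymbol{x};1)}+\sin\alpha\,\delta_{(\boldsymbol{x};0)}$,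 $C\delta_{(\boldsymbol{x};3)}=-\sin\alpha\,\delta_{(\boldsymbol{x};1)}+\cos\alpha\,\delta_{(\boldsymbol{x};0)}$. The shift is $(S\psi)(a)=\psi(\bar a)$, and the time evolution is $U=SC$. For $p\in(0,1)$ the Konno density is $$f_K(x;p)=\frac{\sqrt{1-p^2}}{\pi(1-x^2)\sqrt{p^2-x^2}}\,\mathbf{1}_{(-p,p)}(x).$$ *)

theory Defs
  imports "HOL-Analysis.Analysis"
begin

datatype dir = D0 | D1 | D2 | D3

lemma UNIV_dir: "(UNIV :: dir set) = {D0, D1, D2, D3}"
  using dir.exhaust by blast

instance dir :: finite
  by standard (simp add: UNIV_dir)

type_synonym vertex = "nat \<times> int"

(* Every pair (x, d) is an arc with terminus x, so the arc set is the whole type. *)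
type_synonym arc = "vertex \<times> dir"

definition terminus :: "arc \<Rightarrow> vertex" where
  "terminus = fst"

fun origin :: "arc \<Rightarrow> vertex" where
  "origin ((i, j), D0) = (i + 1, j)"
| "origin ((i, j), D1) = (if i = 0 then (i, j) else (i - 1, j))"
| "origin ((i, j), D2) = (i, j + 1)"
| "origin ((i, j), D3) = (i, j - 1)"

fun inv_arc :: "arc \<Rightarrow> arc" where
  "inv_arc ((i, j), D0) = ((i + 1, j), D1)"
| "inv_arc ((i, j), D1) = (if i = 0 then ((i, j), D1) else ((i - 1, j), D0))"
| "inv_arc ((i, j), D2) = ((i, j + 1), D3)"
| "inv_arc ((i, j), D3) = ((i, j - 1), D2)"

lemma origin_inv_arc: "origin (inv_arc a) = terminus a"
  by (cases a rule: inv_arc.cases) (auto simp: terminus_def)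

lemma terminus_inv_arc: "terminus (inv_arc a) = origin a"
  by (cases a rule: inv_arc.cases) (auto simp: terminus_def)

lemma inv_arc_inv_arc [simp]: "inv_arc (inv_arc a) = a"
  by (cases a rule: inv_arc.cases) auto

lemma inv_arc_eq_self_iff: "inv_arc a = a \<longleftrightarrow> (\<exists>j. a = ((0, j), D1))"
  by (cases a rule: inv_arc.cases) auto

definition kdelta :: "arc \<Rightarrow> arc \<Rightarrow> complex" where
  "kdelta a = (\<lambda>b. if b = a then 1 else 0)"

(* coin_coeff \<alpha> \<beta> d d' is the coefficient of kdelta (x, d) in the image of kdelta (x, d')
   under the coin, see the lemmas coin_kdelta below. *)
fun coin_coeff :: "real \<Rightarrow> real \<Rightarrow> dir \<Rightarrow> dir \<Rightarrow> real" where
  "coin_coeff \<alpha> \<beta> D3 D0 = cos \<beta>"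
| "coin_coeff \<alpha> \<beta> D2 D0 = sin \<beta>"
| "coin_coeff \<alpha> \<beta> D3 D1 = - sin \<beta>"
| "coin_coeff \<alpha> \<beta> D2 D1 = cos \<beta>"
| "coin_coeff \<alpha> \<beta> D1 D2 = cos \<alpha>"
| "coin_coeff \<alpha> \<beta> D0 D2 = sin \<alpha>"
| "coin_coeff \<alpha> \<beta> D1 D3 = - sin \<alpha>"
| "coin_coeff \<alpha> \<beta> D0 D3 = cos \<alpha>"
| "coin_coeff _ _ _ _ = 0"

(* The coin acts locally at each vertex, so coin and shift are given by pointwise formulas on
   all complex functions on arcs. On square-summable functions they are unitary, as the lemmas
   below show (linear, bijective, and preserving the squared norm). *)
definition coin :: "real \<Rightarrow> real \<Rightarrow> (arc \<Rightarrow> complex) \<Rightarrow> (arc \<Rightarrow> complex)" where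
  "coin \<alpha> \<beta> \<psi> = (\<lambda>(x, d). \<Sum>d'\<in>UNIV. of_real (coin_coeff \<alpha> \<beta> d d') * \<psi> (x, d'))"

definition shift :: "(arc \<Rightarrow> complex) \<Rightarrow> (arc \<Rightarrow> complex)" where
  "shift \<psi> = (\<lambda>a. \<psi> (inv_arc a))"

definition evolution :: "real \<Rightarrow> real \<Rightarrow> (arc \<Rightarrow> complex) \<Rightarrow> (arc \<Rightarrow> complex)" where
  "evolution \<alpha> \<beta> = shift \<circ> coin \<alpha> \<beta>"

lemma coin_kdelta:
  "coin \<alpha> \<beta> (kdelta (x, D0)) =
     (\<lambda>a. of_real (cos \<beta>) * kdelta (x, D3) a + of_real (sin \<beta>) * kdelta (x, D2) a)"
  "coin \<alpha> \<beta> (kdelta (x, D1)) =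
     (\<lambda>a. - of_real (sin \<beta>) * kdelta (x, D3) a + of_real (cos \<beta>) * kdelta (x, D2) a)"
  "coin \<alpha> \<beta> (kdelta (x, D2)) =
     (\<lambda>a. of_real (cos \<alpha>) * kdelta (x, D1) a + of_real (sin \<alpha>) * kdelta (x, D0) a)"
  "coin \<alpha> \<beta> (kdelta (x, D3)) =
     (\<lambda>a. - of_real (sin \<alpha>) * kdelta (x, D1) a + of_real (cos \<alpha>) * kdelta (x, D0) a)"
proof -
  have *: "f = g" if "\<And>y d. f (y, d) = g (y, d)" for f g :: "arc \<Rightarrow> complex"
    using that by auto
  show "coin \<alpha> \<beta> (kdelta (x, D0)) =
     (\<lambda>a. of_real (cos \<beta>) * kdelta (x, D3) a + of_real (sin \<beta>) * kdelta (x, D2) a)"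
    by (rule *, case_tac d) (auto simp: coin_def kdelta_def UNIV_dir)
  show "coin \<alpha> \<beta> (kdelta (x, D1)) =
     (\<lambda>a. - of_real (sin \<beta>) * kdelta (x, D3) a + of_real (cos \<beta>) * kdelta (x, D2) a)"
    by (rule *, case_tac d) (auto simp: coin_def kdelta_def UNIV_dir)
  show "coin \<alpha> \<beta> (kdelta (x, D2)) =
     (\<lambda>a. of_real (cos \<alpha>) * kdelta (x, D1) a + of_real (sin \<alpha>) * kdelta (x, D0) a)"
    by (rule *, case_tac d) (auto simp: coin_def kdelta_def UNIV_dir)
  show "coin \<alpha> \<beta> (kdelta (x, D3)) =
     (\<lambda>a. - of_real (sin \<alpha>) * kdelta (x, D1) a + of_real (cos \<alpha>) * kdelta (x, D0) a)"
    by (rule *, case_tac d) (auto simp: coin_def kdelta_def UNIV_dir)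
qed

lemma coin_linear:
  "coin \<alpha> \<beta> (\<lambda>a. u * \<phi> a + v * \<psi> a) = (\<lambda>a. u * coin \<alpha> \<beta> \<phi> a + v * coin \<alpha> \<beta> \<psi> a)"
  by (auto simp: coin_def fun_eq_iff UNIV_dir algebra_simps)

definition coin_adj :: "real \<Rightarrow> real \<Rightarrow> (arc \<Rightarrow> complex) \<Rightarrow> (arc \<Rightarrow> complex)" where
  "coin_adj \<alpha> \<beta> \<psi> = (\<lambda>(x, d). \<Sum>d'\<in>UNIV. of_real (coin_coeff \<alpha> \<beta> d' d) * \<psi> (x, d'))"

lemma sin_cos_cancel:
  "complex_of_real (sin t) * (complex_of_real (sin t) * z)
     + complex_of_real (cos t) * (complex_of_real (cos t) * z) = z"
  "complex_of_real (cos t) * (complex_of_real (cos t) * z)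
     + complex_of_real (sin t) * (complex_of_real (sin t) * z) = z"
proof -
  have "complex_of_real ((sin t)\<^sup>2 + (cos t)\<^sup>2) * z = z"
    by simp
  then show "complex_of_real (sin t) * (complex_of_real (sin t) * z)
     + complex_of_real (cos t) * (complex_of_real (cos t) * z) = z"
    by (simp only: of_real_add of_real_power power2_eq_square of_real_mult distrib_right mult.assoc)
  then show "complex_of_real (cos t) * (complex_of_real (cos t) * z)
     + complex_of_real (sin t) * (complex_of_real (sin t) * z) = z"
    by (simp only: add.commute)
qed

lemma coin_adj_coin: "coin_adj \<alpha> \<beta> (coin \<alpha> \<beta> \<psi>) = \<psi>"
proof
  fix a :: arc
  obtain x d where a: "a = (x, d)" by (cases a)
  show "coin_adj \<alpha> \<beta> (coin \<alpha> \<beta> \<psi>) a = \<psi> a"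
    unfolding a coin_adj_def coin_def
    by (cases d) (simp_all add: UNIV_dir algebra_simps sin_cos_cancel)
qed

lemma coin_coin_adj: "coin \<alpha> \<beta> (coin_adj \<alpha> \<beta> \<psi>) = \<psi>"
proof
  fix a :: arc
  obtain x d where a: "a = (x, d)" by (cases a)
  show "coin \<alpha> \<beta> (coin_adj \<alpha> \<beta> \<psi>) a = \<psi> a"
    unfolding a coin_adj_def coin_def
    by (cases d) (simp_all add: UNIV_dir algebra_simps sin_cos_cancel)
qed

lemma bij_coin: "bij (coin \<alpha> \<beta>)"
  by (rule bij_betw_byWitness[where f' = "coin_adj \<alpha> \<beta>"])
     (auto simp: coin_adj_coin coin_coin_adj)

lemma coin_norm_vertex:
  "(\<Sum>d\<in>UNIV. (cmod (coin \<alpha> \<beta> \<psi> (x, d)))\<^sup>2) = (\<Sum>d\<in>UNIV. (cmod (\<psi> (x, d)))\<^sup>2)"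
proof -
  have real_rot: "(c * p - s * q)\<^sup>2 + (c * p' - s * q')\<^sup>2
       + ((s * p + c * q)\<^sup>2 + (s * p' + c * q')\<^sup>2) = p\<^sup>2 + p'\<^sup>2 + (q\<^sup>2 + q'\<^sup>2)"
    if "s\<^sup>2 + c\<^sup>2 = 1" for c s p q p' q' :: real
    using that by algebra
  have rot: "(cmod (of_real (cos t) * u - of_real (sin t) * v))\<^sup>2
       + (cmod (of_real (sin t) * u + of_real (cos t) * v))\<^sup>2 = (cmod u)\<^sup>2 + (cmod v)\<^sup>2"
    for t u v
    using real_rot[OF sin_cos_squared_add[of t]] by (simp add: cmod_power2)
  show ?thesis
    using rot[of \<alpha> "\<psi> (x, D2)" "\<psi> (x, D3)"] rot[of \<beta> "\<psi> (x, D0)" "\<psi> (x, D1)"]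
    by (simp add: coin_def UNIV_dir algebra_simps)
qed

lemma has_sum_vertexwise:
  fixes \<phi> \<psi> :: "arc \<Rightarrow> complex"
  assumes "((\<lambda>a. (cmod (\<psi> a))\<^sup>2) has_sum N) UNIV"
    and "\<And>x. (\<Sum>d\<in>UNIV. (cmod (\<phi> (x, d)))\<^sup>2) = (\<Sum>d\<in>UNIV. (cmod (\<psi> (x, d)))\<^sup>2)"
  shows "((\<lambda>a. (cmod (\<phi> a))\<^sup>2) has_sum N) UNIV"
proof -
  let ?g = "\<lambda>x. \<Sum>d\<in>UNIV. (cmod (\<psi> (x, d)))\<^sup>2"
  have fin: "((\<lambda>d. (cmod (\<phi> (x, d)))\<^sup>2) has_sum (\<Sum>d\<in>UNIV. (cmod (\<phi> (x, d)))\<^sup>2)) UNIV"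
    for \<phi> :: "arc \<Rightarrow> complex" and x
    by (rule has_sum_finite) simp
  have g: "(?g has_sum N) UNIV"
    by (rule has_sum_SigmaD[where f = "\<lambda>a. (cmod (\<psi> a))\<^sup>2" and B = "\<lambda>_. UNIV"])
       (use assms(1) fin in auto)
  have fin': "((\<lambda>d. (cmod (\<phi> (x, d)))\<^sup>2) has_sum ?g x) UNIV" for x
    using fin[of \<phi> x] by (simp only: assms(2))
  have summ: "(\<lambda>a. (cmod (\<phi> a))\<^sup>2) summable_on (Sigma UNIV (\<lambda>_. UNIV))"
    by (rule summable_on_SigmaI[where g = ?g]) (use fin' g in \<open>auto simp: summable_on_def\<close>)
  show ?thesis
    using has_sum_SigmaI[OF fin' g summ] by simp
qed

lemma coin_norm:
  "((\<lambda>a. (cmod (coin \<alpha> \<beta> \<psi> a))\<^sup>2) has_sum N) UNIV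
     \<longleftrightarrow> ((\<lambda>a. (cmod (\<psi> a))\<^sup>2) has_sum N) UNIV"
  using has_sum_vertexwise[of \<psi> N "coin \<alpha> \<beta> \<psi>"] has_sum_vertexwise[of "coin \<alpha> \<beta> \<psi>" N \<psi>]
    coin_norm_vertex[of \<alpha> \<beta> \<psi>]
  by metis

lemma bij_inv_arc: "bij inv_arc"
  by (rule bij_betw_byWitness[where f' = inv_arc]) auto

lemma bij_shift: "bij shift"
  by (rule bij_betw_byWitness[where f' = shift]) (auto simp: shift_def)

lemma shift_linear:
  "shift (\<lambda>a. u * \<phi> a + v * \<psi> a) = (\<lambda>a. u * shift \<phi> a + v * shift \<psi> a)"
  by (simp add: shift_def)

lemma shift_norm:
  "((\<lambda>a. (cmod (shift \<psi> a))\<^sup>2) has_sum N) UNIV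
     \<longleftrightarrow> ((\<lambda>a. (cmod (\<psi> a))\<^sup>2) has_sum N) UNIV"
  unfolding shift_def
  by (rule has_sum_reindex_bij_betw[OF bij_inv_arc, of "\<lambda>a. (cmod (\<psi> a))\<^sup>2" N])

definition walk_state :: "real \<Rightarrow> real \<Rightarrow> nat \<Rightarrow> (arc \<Rightarrow> complex)" where
  "walk_state \<alpha> \<beta> n = (evolution \<alpha> \<beta> ^^ (2 * n)) (kdelta ((0, 0), D1))"

definition nu :: "real \<Rightarrow> real \<Rightarrow> nat \<Rightarrow> nat \<Rightarrow> int \<Rightarrow> real" where
  "nu \<alpha> \<beta> n k m =
     (if even k then (cmod (walk_state \<alpha> \<beta> n ((k div 2, m), D1)))\<^sup>2
      else (cmod (walk_state \<alpha> \<beta> n ((k div 2, m), D0)))\<^sup>2)"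

definition konno_density :: "real \<Rightarrow> real \<Rightarrow> real" where
  "konno_density x p =
     sqrt (1 - p\<^sup>2) / (pi * (1 - x\<^sup>2) * sqrt (p\<^sup>2 - x\<^sup>2)) * indicator {- p<..<p} x"

definition zeta :: "real \<Rightarrow> real \<Rightarrow> real \<Rightarrow> real" where
  "zeta s r y = (\<bar>r\<bar> - \<bar>s\<bar> * \<bar>y\<bar>) / (\<bar>r\<bar> + \<bar>s\<bar> * \<bar>y\<bar>)"

(* Only used for s * r \<noteq> 0, so that the second branch means s * r < 0. *)
definition chi :: "real \<Rightarrow> real \<Rightarrow> real \<Rightarrow> real" where
  "chi s r = (if s * r > 0 then indicator {0..} else indicator {..0})"

definition limit_density :: "real \<Rightarrow> real \<Rightarrow> nat \<Rightarrow> real \<Rightarrow> real" where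
  "limit_density s r k y =
     2 * s\<^sup>2 / r\<^sup>2 * y\<^sup>2 * konno_density y \<bar>r\<bar>
       * zeta s r y ^ (if even k then k div 2 else k div 2 + 1) * chi s r y"

end

theory Submission
  imports Defs "HOL-Probability.Probability"
begin

text \<open>
  A Fourier transform in the second coordinate turns \<open>U\<^sup>2\<close> on the arcs \<open>D0\<close>, \<open>D1\<close> into a quantum walk on
  the half-line whose coin \<open>(a k, b k)\<close> depends on the momentum \<open>k\<close> only. The generating functions of
  its amplitudes are rational in \<open>z\<close> and in one root of \<open>z V\<^sup>2 - (1 + z\<^sup>2) V + z \<bar>b\<bar>\<^sup>2 = 0\<close>. That root
  is built from series of the form \<open>sqrt (1 - \<eta> z)\<close>, so its coefficients are absolutely summable,
  uniformly in \<open>k\<close>. Of the two simple poles on the unit circle one cancels, and the other is the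
  bound state at the boundary: it alone survives as \<open>n \<rightarrow> \<infinity>\<close>, with eigenvalue \<open>\<lambda> k\<close>. Hence the
  characteristic function of \<open>\<nu>\<close> at the scale \<open>m / n\<close>, which by Parseval is the mean over \<open>k\<close> of
  \<open>cnj (\<psi> k) * \<psi> (k - t / n)\<close>, tends to the mean of the squared bound state times \<open>exp (\<i> t v k)\<close>,
  where \<open>v\<close> is the group velocity of \<open>\<lambda>\<close>. Levy's continuity theorem and the substitution
  \<open>y = v k\<close> finish the proof.
\<close>

section \<open>Absolutely summable power series\<close>

text \<open>An expansion for each fixed \<open>k\<close> would not suffice: the correlation pairs
  the momenta \<open>k\<close> and \<open>k - t / n\<close>, and the second one moves with time. The
  error must be controlled along such sequences, so the series are accompanied by coefficientwise
  majorants that are the same for all momenta. Absolute summability up to the unit circle is exactly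
  what the poles require. Multiplying such a series by \<open>1 / (1 - l z)\<close> with
  \<open>norm l = 1\<close> gives coefficients \<open>l ^ n\<close> times its partial sums at
  \<open>1 / l\<close>; the error is at most a tail of the majorant. The scale \<open>m / n\<close>
  comes from the phase of the bound state. At one momentum \<open>\<lambda> k ^ n\<close>
  oscillates, but against its conjugate at distance \<open>t / n\<close> the phase difference
  converges to \<open>t\<close> times a derivative. The Konno density has the same origin: up to
  folding onto one half-line, it is the image of the uniform distribution of \<open>k\<close> under
  the group velocity, while the remaining factors of the limit are the squared bound state rewritten
  in \<open>y\<close>.\<close>

definition abs_summable :: "'a::real_normed_field fps \<Rightarrow> bool" where
  "abs_summable f \<longleftrightarrow> summable (\<lambda>n. norm (fps_nth f n))"

definition fps_sum :: "complex fps \<Rightarrow> complex \<Rightarrow> complex" where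
  "fps_sum f z = (\<Sum>n. fps_nth f n * z ^ n)"

definition majorized :: "complex fps \<Rightarrow> real fps \<Rightarrow> bool" where
  "majorized f D \<longleftrightarrow> (\<forall>n. norm (fps_nth f n) \<le> fps_nth D n)"

lemma majorized_nonneg: "majorized f D \<Longrightarrow> 0 \<le> fps_nth D n"
  unfolding majorized_def using norm_ge_zero order_trans by blast

lemma majorized_mult:
  assumes "majorized f D" "majorized g E"
  shows "majorized (f * g) (D * E)"
  unfolding majorized_def fps_mult_nth
proof
  fix n
  show "norm (\<Sum>i=0..n. fps_nth f i * fps_nth g (n - i)) \<le> (\<Sum>i=0..n. fps_nth D i * fps_nth E (n - i))"
    by (rule sum_norm_le)
       (use assms majorized_nonneg[OF assms(1)] in \<open>auto simp: norm_mult majorized_def intro!: mult_mono\<close>)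
qed

lemma majorized_add: "majorized f D \<Longrightarrow> majorized g E \<Longrightarrow> majorized (f + g) (D + E)"
  unfolding majorized_def by (auto intro: norm_triangle_le add_mono)

lemma majorized_minus: "majorized f D \<Longrightarrow> majorized (- f) D"
  unfolding majorized_def by auto

lemma majorized_diff: "majorized f D \<Longrightarrow> majorized g E \<Longrightarrow> majorized (f - g) (D + E)"
  using majorized_add[of f D "- g" E] majorized_minus by simp

lemma majorized_const: "norm c \<le> C \<Longrightarrow> majorized (fps_const c) (fps_const C)"
  unfolding majorized_def by auto

lemma majorized_one: "majorized 1 1"
  unfolding majorized_def by auto

lemma majorized_X: "majorized fps_X fps_X"
  unfolding majorized_def by (auto simp: fps_X_def)

lemma majorized_power: "majorized f D \<Longrightarrow> majorized (f ^ n) (D ^ n)"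
  by (induction n) (auto intro: majorized_mult majorized_one)

lemma abs_summable_add: "abs_summable f \<Longrightarrow> abs_summable g \<Longrightarrow> abs_summable (f + g)"
  unfolding abs_summable_def
  by (rule summable_comparison_test'[where g = "\<lambda>n. norm (fps_nth f n) + norm (fps_nth g n)" and N = 0])
     (auto intro: summable_add norm_triangle_ineq)

lemma abs_summable_minus: "abs_summable f \<Longrightarrow> abs_summable (- f)"
  unfolding abs_summable_def by simp

lemma abs_summable_diff: "abs_summable f \<Longrightarrow> abs_summable g \<Longrightarrow> abs_summable (f - g)"
  using abs_summable_add[of f "- g"] abs_summable_minus[of g] by simp

lemma abs_summable_mult:
  assumes "abs_summable f" "abs_summable g"
  shows "abs_summable (f * g)"
proof -
  have "summable (\<lambda>n. \<Sum>i\<le>n. norm (fps_nth f i) * norm (fps_nth g (n - i)))"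
    by (rule summable_Cauchy_product) (use assms in \<open>auto simp: abs_summable_def\<close>)
  then show ?thesis
    unfolding abs_summable_def fps_mult_nth atLeast0AtMost
    by (rule summable_comparison_test'[where N = 0])
       (auto simp: norm_mult intro!: sum_norm_le)
qed

lemma abs_summable_const: "abs_summable (fps_const c)"
  unfolding abs_summable_def by (rule summable_finite[of "{0}"]) auto

lemma abs_summable_one: "abs_summable 1"
  using abs_summable_const[of 1] by simp

lemma abs_summable_X: "abs_summable fps_X"
  unfolding abs_summable_def by (rule summable_finite[of "{1}"]) (auto simp: fps_X_def)

lemma abs_summable_power: "abs_summable f \<Longrightarrow> abs_summable (f ^ n)"
  by (induction n) (auto intro: abs_summable_mult abs_summable_one)

lemma abs_summable_shift: "abs_summable f \<Longrightarrow> abs_summable (fps_shift m f)"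
  unfolding abs_summable_def
  using summable_iff_shift[of "\<lambda>n. norm (fps_nth f n)" m] by simp

lemmas abs_summable_intros = abs_summable_add abs_summable_diff abs_summable_mult
  abs_summable_const abs_summable_one abs_summable_X abs_summable_power abs_summable_shift

lemma majorized_abs_summable:
  assumes "majorized f D" "abs_summable D"
  shows "abs_summable f"
  unfolding abs_summable_def
  by (rule summable_comparison_test'[where N = 0 and g = "fps_nth D"])
     (use assms in \<open>auto simp: majorized_def abs_summable_def intro: summable_norm_cancel\<close>)

section \<open>Values of absolutely summable series on the closed unit disc\<close>

lemma fps_sum_summable_norm:
  fixes f :: "complex fps"
  assumes "abs_summable f" "norm z \<le> 1"
  shows "summable (\<lambda>n. norm (fps_nth f n * z ^ n))"
  using assms(1) unfolding abs_summable_def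
  by (rule summable_comparison_test'[where N = 0])
     (use assms(2) in \<open>auto simp: norm_mult norm_power intro!: mult_left_le power_le_one\<close>)

lemma fps_sum_summable:
  fixes f :: "complex fps"
  assumes "abs_summable f" "norm z \<le> 1"
  shows "summable (\<lambda>n. fps_nth f n * z ^ n)"
  by (rule summable_norm_cancel[OF fps_sum_summable_norm[OF assms]])

lemma fps_sum_add:
  "abs_summable f \<Longrightarrow> abs_summable g \<Longrightarrow> norm z \<le> 1 \<Longrightarrow> fps_sum (f + g) z = fps_sum f z + fps_sum g z"
  unfolding fps_sum_def by (subst suminf_add) (auto intro: fps_sum_summable simp: distrib_right)

lemma fps_sum_diff:
  "abs_summable f \<Longrightarrow> abs_summable g \<Longrightarrow> norm z \<le> 1 \<Longrightarrow> fps_sum (f - g) z = fps_sum f z - fps_sum g z"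
  unfolding fps_sum_def by (subst suminf_diff) (auto intro: fps_sum_summable simp: left_diff_distrib)

lemma fps_sum_mult:
  assumes "abs_summable f" "abs_summable g" "norm z \<le> 1"
  shows "fps_sum (f * g) z = fps_sum f z * fps_sum g z"
proof -
  have *: "(\<Sum>i\<le>n. fps_nth f i * z ^ i * (fps_nth g (n - i) * z ^ (n - i)))
      = (\<Sum>i\<le>n. fps_nth f i * fps_nth g (n - i)) * z ^ n" for n
    unfolding sum_distrib_right
    by (rule sum.cong) (auto simp: power_add[symmetric])
  show ?thesis
    using Cauchy_product[of "\<lambda>n. fps_nth f n * z ^ n" "\<lambda>n. fps_nth g n * z ^ n"]
      fps_sum_summable_norm[OF assms(1,3)] fps_sum_summable_norm[OF assms(2,3)]
    by (simp only: fps_sum_def fps_mult_nth atLeast0AtMost *)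
qed

lemma fps_sum_const [simp]: "fps_sum (fps_const c) z = c"
  unfolding fps_sum_def by (subst suminf_finite[of "{0}"]) auto

lemma fps_sum_one [simp]: "fps_sum 1 z = 1"
  using fps_sum_const[of 1] by simp

lemma fps_sum_X [simp]: "fps_sum fps_X z = z"
  unfolding fps_sum_def by (subst suminf_finite[of "{1}"]) (auto simp: fps_X_def)

lemma fps_sum_power:
  "abs_summable f \<Longrightarrow> norm z \<le> 1 \<Longrightarrow> fps_sum (f ^ n) z = fps_sum f z ^ n"
  by (induction n) (auto simp: fps_sum_mult abs_summable_power)

lemmas fps_sum_simps = fps_sum_add fps_sum_diff fps_sum_mult fps_sum_power

section \<open>Square root series\<close>

text \<open>The binomial series of the square root of \<open>1 - \<eta> z\<close>. As a composition
  it inherits its square from the addition law of the binomial series.\<close>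

definition sqrt_fps :: "complex \<Rightarrow> complex fps" where
  "sqrt_fps \<eta> = fps_compose (fps_binomial (1/2)) (fps_const (- \<eta>) * fps_X)"

lemma sqrt_fps_nth: "fps_nth (sqrt_fps \<eta>) n = (1/2 gchoose n) * (- \<eta>) ^ n"
  by (simp add: sqrt_fps_def fps_compose_linear)

lemma sqrt_fps_square: "sqrt_fps \<eta> * sqrt_fps \<eta> = 1 - fps_const \<eta> * fps_X"
proof -
  have "sqrt_fps \<eta> * sqrt_fps \<eta>
      = fps_compose (fps_binomial (1/2) * fps_binomial (1/2)) (fps_const (- \<eta>) * fps_X)"
    unfolding sqrt_fps_def by (subst fps_compose_mult_distrib) auto
  also have "fps_binomial (1/2) * fps_binomial (1/2) = (1 + fps_X :: complex fps)"
    by (simp flip: fps_binomial_add_mult add: fps_binomial_1)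
  also have "fps_compose (1 + fps_X) (fps_const (- \<eta>) * fps_X) = 1 - fps_const \<eta> * fps_X"
    by (simp add: fps_compose_add_distrib flip: fps_const_neg)
  finally show ?thesis .
qed

definition sqrt_majorant :: "real fps" where
  "sqrt_majorant = Abs_fps (\<lambda>n. \<bar>1/2 gchoose n\<bar>)"

text \<open>With the alternating sign the coefficient is a Pochhammer product starting at
  \<open>-1/2\<close>, whose only negative factor is the first. So all coefficients of
  \<open>sqrt (1 - x)\<close> after the constant one are nonpositive.\<close>

lemma gbinomial_half_sign: "n > 0 \<Longrightarrow> \<bar>(1/2::real) gchoose n\<bar> = - ((1/2 gchoose n) * (-1) ^ n)"
proof -
  assume "n > 0"
  then obtain m where n: "n = Suc m" by (cases n) auto
  have "(1/2 gchoose n) * (-1) ^ n = (pochhammer (-1/2) n / fact n :: real)"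
    by (simp add: gbinomial_pochhammer)
  also have "\<dots> = - (1/2 * pochhammer (1/2) m / fact n)"
    by (simp add: n pochhammer_rec)
  finally have *: "(1/2 gchoose n) * (-1) ^ n = (- (1/2 * pochhammer (1/2) m / fact n) :: real)" .
  have "(1/2 gchoose n) * (-1) ^ n \<le> (0::real)"
    unfolding * using pochhammer_nonneg[of "1/2::real" m] by simp
  then have "\<bar>(1/2 gchoose n) * (-1) ^ n\<bar> = - ((1/2 gchoose n) * (-1::real) ^ n)" by simp
  then show ?thesis by (simp add: abs_mult)
qed

text \<open>The partial sums of the series of \<open>sqrt (1 - x)\<close> at \<open>x = 1\<close>
  have a closed form that is nonnegative. They start at 1 and then only decrease, so the moduli of
  the later terms cannot add up to more than 1.\<close>

lemma sum_gbinomial_half_le: "(\<Sum>n<m. \<bar>1/2 gchoose Suc n\<bar>) \<le> (1::real)"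
proof -
  have "0 \<le> (-1) ^ m * (1/2 - 1 gchoose m :: real)"
    using pochhammer_nonneg[of "1/2::real" m] by (simp add: gbinomial_pochhammer)
  also have "\<dots> = (\<Sum>k\<le>m. (1/2 gchoose k) * (- 1) ^ k)"
    by (rule gbinomial_sum_lower_neg[symmetric])
  also have "\<dots> = 1 + (\<Sum>k<m. (1/2 gchoose Suc k) * (- 1) ^ Suc k)"
    by (subst sum.atMost_shift) simp
  also have "(\<Sum>k<m. (1/2 gchoose Suc k) * (- 1) ^ Suc k) = - (\<Sum>n<m. \<bar>1/2 gchoose Suc n :: real\<bar>)"
    unfolding sum_negf[symmetric] by (rule sum.cong) (simp_all add: gbinomial_half_sign)
  finally show ?thesis by simp
qed

lemma summable_gbinomial_half: "summable (\<lambda>n. \<bar>1/2 gchoose Suc n :: real\<bar>)"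
  by (rule summableI_nonneg_bounded[OF _ sum_gbinomial_half_le]) auto

lemma abs_summable_sqrt_majorant: "abs_summable sqrt_majorant"
  using summable_gbinomial_half
  by (simp add: abs_summable_def sqrt_majorant_def summable_Suc_iff[of "\<lambda>n. \<bar>1/2 gchoose n\<bar>"])

lemma gbinomial_half_complex: "(1/2 gchoose n :: complex) = of_real (1/2 gchoose n)"
  by (simp add: gbinomial_prod_rev)

lemma majorized_sqrt_fps: "norm \<eta> \<le> 1 \<Longrightarrow> majorized (sqrt_fps \<eta>) sqrt_majorant"
  by (auto simp: majorized_def sqrt_fps_nth sqrt_majorant_def gbinomial_half_complex norm_mult
      norm_power mult_left_le power_le_one)

lemma abs_summable_sqrt_fps: "norm \<eta> \<le> 1 \<Longrightarrow> abs_summable (sqrt_fps \<eta>)"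
  using majorized_sqrt_fps abs_summable_sqrt_majorant majorized_abs_summable by blast

text \<open>On the closed disc the series is 1 plus a remainder of norm at most 1. This half-plane
  bound later identifies the branch of the root on the unit circle.\<close>

lemma Re_fps_sum_sqrt_nonneg:
  assumes "norm \<eta> \<le> 1" "norm z \<le> 1"
  shows "0 \<le> Re (fps_sum (sqrt_fps \<eta>) z)"
proof -
  let ?f = "\<lambda>n. fps_nth (sqrt_fps \<eta>) n * z ^ n"
  have s: "summable ?f" using fps_sum_summable abs_summable_sqrt_fps assms by blast
  have le: "norm (?f (Suc n)) \<le> \<bar>1/2 gchoose Suc n\<bar>" for n
  proof -
    have "norm (?f (Suc n)) = \<bar>1/2 gchoose Suc n\<bar> * (norm \<eta> * norm z) ^ Suc n"
      by (simp add: sqrt_fps_nth gbinomial_half_complex norm_mult norm_power power_mult_distrib)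
    also have "\<dots> \<le> \<bar>1/2 gchoose Suc n\<bar>"
      using assms by (intro mult_left_le power_le_one) (auto intro: mult_le_one)
    finally show ?thesis .
  qed
  have "norm (\<Sum>n. ?f (Suc n)) \<le> (\<Sum>n. \<bar>1/2 gchoose Suc n :: real\<bar>)"
    by (rule norm_suminf_le[OF le summable_gbinomial_half])
  also have "\<dots> \<le> 1"
    using sum_gbinomial_half_le by (intro suminf_le_const summable_gbinomial_half) auto
  finally have "\<bar>Re (\<Sum>n. ?f (Suc n))\<bar> \<le> 1" using abs_Re_le_cmod order_trans by blast
  moreover have "fps_sum (sqrt_fps \<eta>) z = (\<Sum>n. ?f (Suc n)) + 1"
    unfolding fps_sum_def using suminf_split_head[OF s] by (simp add: sqrt_fps_nth)
  ultimately show ?thesis by simp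
qed

lemma majorized_shift: "majorized f D \<Longrightarrow> majorized (fps_shift m f) (fps_shift m D)"
  unfolding majorized_def by simp

section \<open>The decaying root of the characteristic equation\<close>

text \<open>The factors come from \<open>(1 + z\<^sup>2)\<^sup>2 - 4 B\<^sup>2 z\<^sup>2 = (1 - \<eta>\<^sup>2 z\<^sup>2) (1 - cnj \<eta>\<^sup>2 z\<^sup>2)\<close> with \<open>\<bar>\<eta>\<bar> = 1\<close>,
  \<open>Re \<eta> = B\<close>.\<close>

definition disc_fps :: "real \<Rightarrow> complex fps" where
  "disc_fps B = (let \<eta> = Complex B (sqrt (1 - B\<^sup>2)) in
     (sqrt_fps \<eta> * sqrt_fps (- \<eta>)) * (sqrt_fps (cnj \<eta>) * sqrt_fps (- cnj \<eta>)))"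

text \<open>The root formula for the quadratic equation. The minus sign selects the root that is a
  power series: the constant terms cancel, and the shift divides by \<open>z\<close>.\<close>

definition decay_fps :: "real \<Rightarrow> complex fps" where
  "decay_fps B = fps_const (1/2) * fps_shift 1 (1 + fps_X ^ 2 - disc_fps B)"

definition decay_majorant :: "real fps" where
  "decay_majorant = fps_const (1/2) * fps_shift 1 (1 + fps_X ^ 2 +
     (sqrt_majorant * sqrt_majorant) * (sqrt_majorant * sqrt_majorant))"

lemma norm_Complex_sqrt: "0 \<le> B \<Longrightarrow> B \<le> 1 \<Longrightarrow> norm (Complex B (sqrt (1 - B\<^sup>2))) = 1"
  by (simp add: cmod_def abs_square_le_1)

lemma sqrt_fps_pair: "(sqrt_fps \<eta> * sqrt_fps (- \<eta>)) * (sqrt_fps \<eta> * sqrt_fps (- \<eta>))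
    = 1 - fps_const (\<eta>\<^sup>2) * fps_X ^ 2"
proof -
  have "(sqrt_fps \<eta> * sqrt_fps (- \<eta>)) * (sqrt_fps \<eta> * sqrt_fps (- \<eta>))
     = (sqrt_fps \<eta> * sqrt_fps \<eta>) * (sqrt_fps (- \<eta>) * sqrt_fps (- \<eta>))" by (simp add: mult_ac)
  also have "\<dots> = 1 - fps_const (\<eta>\<^sup>2) * fps_X ^ 2"
    unfolding sqrt_fps_square
    by (simp add: algebra_simps power2_eq_square flip: fps_const_neg fps_const_mult)
  finally show ?thesis .
qed

lemma disc_fps_square:
  assumes "0 \<le> B" "B \<le> 1"
  shows "disc_fps B * disc_fps B = (1 + fps_X ^ 2) ^ 2 - fps_const (4 * of_real B ^ 2) * fps_X ^ 2"
proof -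
  define \<eta> where "\<eta> = Complex B (sqrt (1 - B\<^sup>2))"
  have 1: "\<eta>\<^sup>2 * cnj \<eta> ^ 2 = 1"
    using norm_Complex_sqrt[OF assms] complex_norm_square[of \<eta>]
    by (simp add: \<eta>_def flip: power_mult_distrib)
  have "\<eta> + cnj \<eta> = 2 * of_real B"
    by (simp add: \<eta>_def complex_eq_iff)
  then have "(\<eta> + cnj \<eta>)\<^sup>2 = 4 * of_real B ^ 2" by (simp add: power_mult_distrib)
  moreover have "\<eta> * cnj \<eta> = 1"
    using norm_Complex_sqrt[OF assms] complex_norm_square[of \<eta>] by (simp add: \<eta>_def)
  ultimately have 2: "\<eta>\<^sup>2 + cnj \<eta> ^ 2 = 4 * of_real B ^ 2 - 2"
    by (simp add: power2_eq_square algebra_simps)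
  have "disc_fps B * disc_fps B
      = ((sqrt_fps \<eta> * sqrt_fps (- \<eta>)) * (sqrt_fps \<eta> * sqrt_fps (- \<eta>))) *
        ((sqrt_fps (cnj \<eta>) * sqrt_fps (- cnj \<eta>)) * (sqrt_fps (cnj \<eta>) * sqrt_fps (- cnj \<eta>)))"
    unfolding disc_fps_def Let_def \<eta>_def[symmetric] by (simp only: mult_ac)
  also have "\<dots> = (1 - fps_const (\<eta>\<^sup>2) * fps_X ^ 2) * (1 - fps_const (cnj \<eta> ^ 2) * fps_X ^ 2)"
    by (simp only: sqrt_fps_pair)
  also have "\<dots> = 1 - fps_const (\<eta>\<^sup>2 + cnj \<eta> ^ 2) * fps_X ^ 2
      + fps_const (\<eta>\<^sup>2 * cnj \<eta> ^ 2) * fps_X ^ 4"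
    by (simp add: algebra_simps power4_eq_xxxx power2_eq_square flip: fps_const_add fps_const_mult)
  also have "\<dots> = (1 + fps_X ^ 2) ^ 2 - fps_const (4 * of_real B ^ 2) * fps_X ^ 2"
    unfolding 1 2
    by (simp add: algebra_simps power4_eq_xxxx power2_eq_square numeral_fps_const
        flip: fps_const_add fps_const_mult fps_const_sub)
  finally show ?thesis .
qed

lemma disc_fps_nth_0 [simp]: "fps_nth (disc_fps B) 0 = 1"
  by (simp add: disc_fps_def Let_def sqrt_fps_nth)

lemma X_decay_fps: "2 * fps_X * decay_fps B = 1 + fps_X ^ 2 - disc_fps B"
proof -
  have "fps_const (1/2) * (2 :: complex fps) = 1"
    by (simp add: numeral_fps_const)
  then have "2 * fps_X * decay_fps B = fps_X * fps_shift 1 (1 + fps_X ^ 2 - disc_fps B)"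
    unfolding decay_fps_def by (simp add: mult_ac)
  also have "\<dots> = 1 + fps_X ^ 2 - disc_fps B"
    by (rule fps_ext) (simp add: fps_X_power_nth)
  finally show ?thesis .
qed

lemma decay_fps_quadratic:
  assumes "0 \<le> B" "B \<le> 1"
  shows "fps_X * decay_fps B ^ 2 + fps_X * fps_const (of_real B ^ 2) = (1 + fps_X ^ 2) * decay_fps B"
proof -
  let ?V = "decay_fps B" and ?b = "fps_const (complex_of_real B ^ 2)"
  have "(1 + fps_X ^ 2 - 2 * fps_X * ?V) ^ 2 = (1 + fps_X ^ 2) ^ 2 - 4 * ?b * fps_X ^ 2"
    using disc_fps_square[OF assms] X_decay_fps[of B]
    by (simp add: power2_eq_square numeral_fps_const)
  then have "4 * fps_X * (fps_X * ?V ^ 2 + fps_X * ?b) = 4 * fps_X * ((1 + fps_X ^ 2) * ?V)"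
    by algebra
  then show ?thesis by simp
qed

lemma majorized_disc_fps:
  assumes "0 \<le> B" "B \<le> 1"
  shows "majorized (disc_fps B) ((sqrt_majorant * sqrt_majorant) * (sqrt_majorant * sqrt_majorant))"
  unfolding disc_fps_def Let_def
  by (intro majorized_mult majorized_sqrt_fps) (use norm_Complex_sqrt[OF assms] in auto)

lemma majorized_decay_fps: "0 \<le> B \<Longrightarrow> B \<le> 1 \<Longrightarrow> majorized (decay_fps B) decay_majorant"
  unfolding decay_fps_def decay_majorant_def
  by (intro majorized_mult majorized_const majorized_shift majorized_diff majorized_add
      majorized_one majorized_power majorized_X majorized_disc_fps) auto

lemma abs_summable_decay_majorant: "abs_summable decay_majorant"
  unfolding decay_majorant_def
  by (intro abs_summable_intros abs_summable_sqrt_majorant)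

lemma abs_summable_decay_fps: "0 \<le> B \<Longrightarrow> B \<le> 1 \<Longrightarrow> abs_summable (decay_fps B)"
  using majorized_decay_fps abs_summable_decay_majorant majorized_abs_summable by blast

text \<open>Both factors lie in the sector \<open>\<bar>Im x\<bar> \<le> Re x\<close> of half-angle
  \<open>pi / 4\<close>, and arguments add.\<close>

lemma Re_mult_nonneg:
  assumes "0 \<le> Re x" "0 \<le> Re (x\<^sup>2)" "0 \<le> Re y" "0 \<le> Re (y\<^sup>2)"
  shows "0 \<le> Re (x * y)"
proof -
  have "\<bar>Im x\<bar> \<le> Re x" "\<bar>Im y\<bar> \<le> Re y"
    using assms by (auto simp: Re_power2 intro: power2_le_imp_le)
  then have "\<bar>Im x * Im y\<bar> \<le> Re x * Re y"
    by (auto simp: abs_mult intro!: mult_mono assms)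
  then show ?thesis by simp
qed

text \<open>Four factors in the right half-plane could have a product anywhere, so they are combined
  in two stages. Each factor squares to \<open>1 - v\<close> with \<open>norm v \<le> 1\<close>,
  hence lies in the sector of half-angle \<open>pi / 4\<close>. A pair squares to
  \<open>1 - (\<eta> * z) ^ 2\<close>, again of this form, so the sector argument applies a second
  time.\<close>

lemma Re_fps_sum_disc_nonneg:
  assumes B: "0 \<le> B" "B \<le> 1" and z: "norm z \<le> 1"
  shows "0 \<le> Re (fps_sum (disc_fps B) z)"
proof -
  have le: "0 \<le> Re (1 - v)" if "norm v \<le> 1" for v :: complex
    using that complex_Re_le_cmod[of v] by simp
  have summ: "abs_summable (sqrt_fps \<eta>)" if "norm \<eta> = 1" for \<eta>
    using that abs_summable_sqrt_fps by auto
  have pair: "0 \<le> Re (fps_sum (sqrt_fps \<eta> * sqrt_fps (- \<eta>)) z)"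
    "0 \<le> Re (fps_sum (sqrt_fps \<eta> * sqrt_fps (- \<eta>)) z ^ 2)" if \<eta>: "norm \<eta> = 1" for \<eta>
  proof -
    have s: "fps_sum (sqrt_fps \<eta>') z ^ 2 = 1 - \<eta>' * z" if "norm \<eta>' = 1" for \<eta>'
      using arg_cong[OF sqrt_fps_square[of \<eta>'], of "\<lambda>f. fps_sum f z"] summ[OF that] z
      by (simp add: fps_sum_simps abs_summable_intros power2_eq_square)
    have n: "norm (\<eta>' * z) \<le> 1" if "norm \<eta>' = 1" for \<eta>'
      using that z by (simp add: norm_mult)
    have m: "fps_sum (sqrt_fps \<eta> * sqrt_fps (- \<eta>)) z = fps_sum (sqrt_fps \<eta>) z * fps_sum (sqrt_fps (- \<eta>)) z"
      using \<eta> z by (simp add: fps_sum_mult summ)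
    show "0 \<le> Re (fps_sum (sqrt_fps \<eta> * sqrt_fps (- \<eta>)) z)"
      unfolding m
      using \<eta> z le[OF n[of \<eta>]] le[OF n[of "- \<eta>"]] Re_fps_sum_sqrt_nonneg[of \<eta> z]
         Re_fps_sum_sqrt_nonneg[of "- \<eta>" z]
      by (intro Re_mult_nonneg) (simp_all add: s)
    have "fps_sum (sqrt_fps \<eta> * sqrt_fps (- \<eta>)) z ^ 2 = 1 - (\<eta> * z) ^ 2"
      unfolding m power_mult_distrib[of "fps_sum _ _"] using \<eta>
      by (simp only: s norm_minus_cancel) (simp add: algebra_simps power2_eq_square)
    moreover have "norm ((\<eta> * z) ^ 2) \<le> 1"
      using n[OF \<eta>] by (simp add: norm_power power_le_one)
    ultimately show "0 \<le> Re (fps_sum (sqrt_fps \<eta> * sqrt_fps (- \<eta>)) z ^ 2)"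
      using le by simp
  qed
  let ?\<eta> = "Complex B (sqrt (1 - B\<^sup>2))"
  have \<eta>: "norm ?\<eta> = 1" "norm (cnj ?\<eta>) = 1" using norm_Complex_sqrt[OF B] by auto
  have "fps_sum (disc_fps B) z
      = fps_sum (sqrt_fps ?\<eta> * sqrt_fps (- ?\<eta>)) z * fps_sum (sqrt_fps (cnj ?\<eta>) * sqrt_fps (- cnj ?\<eta>)) z"
    unfolding disc_fps_def Let_def
    by (rule fps_sum_mult) (use \<eta> z in \<open>auto intro!: abs_summable_mult summ\<close>)
  then show ?thesis
    using Re_mult_nonneg[OF pair[OF \<eta>(1)] pair[OF \<eta>(2)]] by simp
qed

lemma abs_summable_disc_fps:
  assumes "0 \<le> B" "B \<le> 1"
  shows "abs_summable (disc_fps B)"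
  using majorized_disc_fps[OF assms]
  by (rule majorized_abs_summable) (intro abs_summable_mult abs_summable_sqrt_majorant)

text \<open>At a point of the unit circle outside the band \<open>\<bar>Re z\<bar> < B\<close> both roots of the quadratic equation
  are real; the half-plane bound on the square root of the discriminant selects the smaller one.\<close>

lemma fps_sum_decay_fps:
  assumes B: "0 \<le> B" "B \<le> 1" and l: "norm l = 1" and c: "(Re l)\<^sup>2 = B\<^sup>2 + c\<^sup>2" and nz: "Re l \<noteq> 0"
  shows "fps_sum (decay_fps B) (cnj l) = of_real (Re l - sgn (Re l) * \<bar>c\<bar>)"
proof -
  let ?z = "cnj l" and ?S = "fps_sum (disc_fps B) (cnj l)" and ?V = "fps_sum (decay_fps B) (cnj l)"
  have z: "norm ?z \<le> 1" "?z \<noteq> 0" using l by auto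
  have lz: "l * ?z = 1" using complex_norm_square[of l] l by simp
  have sum: "?z + l = 2 * of_real (Re l)" by (simp add: complex_eq_iff)
  have S2: "?S * ?S = (1 + ?z ^ 2) ^ 2 - 4 * of_real B ^ 2 * ?z ^ 2"
    using arg_cong[OF disc_fps_square[OF B], of "\<lambda>f. fps_sum f ?z"] z B
    by (simp add: fps_sum_simps abs_summable_intros abs_summable_disc_fps)
  \<comment> \<open>Rotation by \<open>l\<close> makes the discriminant real: since
    \<open>l * cnj l = 1\<close>, its square becomes
    \<open>(l + cnj l) ^ 2 - 4 * B ^ 2 = (2 * c) ^ 2\<close>.\<close>
  define \<sigma> where "\<sigma> = ?S * l"
  have S: "?S = \<sigma> * ?z" unfolding \<sigma>_def using lz by (simp add: mult_ac)
  have "\<sigma>\<^sup>2 = l ^ 2 * (?S * ?S)"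
    unfolding \<sigma>_def by (simp add: power2_eq_square mult_ac)
  also have "\<dots> = (l + (l * ?z) * ?z) ^ 2 - 4 * of_real B ^ 2 * (l * ?z) ^ 2"
    unfolding S2 by (simp add: power2_eq_square algebra_simps)
  also have "\<dots> = (l + ?z) ^ 2 - 4 * of_real B ^ 2" by (simp only: lz) simp
  also have "\<dots> = of_real (4 * ((Re l)\<^sup>2 - B\<^sup>2))"
    using sum by (simp add: add.commute power_mult_distrib algebra_simps)
  also have "\<dots> = of_real (2 * c) ^ 2" unfolding c by simp
  finally have "\<sigma> = of_real (2 * c) \<or> \<sigma> = - of_real (2 * c)" unfolding power2_eq_iff .
  then obtain t where t: "\<sigma> = of_real t" "\<bar>t\<bar> = 2 * \<bar>c\<bar>"
    by (metis abs_minus_cancel abs_mult abs_numeral of_real_minus)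
  \<comment> \<open>The value of the discriminant root is \<open>t * cnj l\<close>, with real part
    \<open>t * Re l\<close>; the half-plane bound thus fixes the sign of \<open>t\<close>.\<close>
  have "0 \<le> t * Re l"
    using Re_fps_sum_disc_nonneg[OF B z(1)] unfolding S t by simp
  then have t': "t = sgn (Re l) * (2 * \<bar>c\<bar>)"
    using t(2) nz by (cases "Re l > 0") (auto simp: zero_le_mult_iff)
  have "2 * ?z * ?V = 1 + ?z ^ 2 - ?S"
    using arg_cong[OF X_decay_fps[of B], of "\<lambda>f. fps_sum f ?z"] z B
    by (simp add: fps_sum_simps abs_summable_intros abs_summable_disc_fps abs_summable_decay_fps
      numeral_fps_const)
  then have "(l * ?z) * (2 * ?V) = l + (l * ?z) * ?z - (l * ?z) * \<sigma>"
    unfolding S by (simp add: power2_eq_square) algebra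
  then have "2 * ?V = l + ?z - \<sigma>" by (simp only: lz) simp
  also have "\<dots> = 2 * of_real (Re l - sgn (Re l) * \<bar>c\<bar>)"
    using sum unfolding t t' by (simp add: add.commute)
  finally show ?thesis by (subst (asm) mult_cancel_left) simp
qed

section \<open>The half-line walk\<close>

text \<open>The pair at \<open>j\<close> collects the amplitudes on the arcs \<open>D1\<close> and \<open>D0\<close> at distance \<open>j\<close> from the
  boundary.\<close>

primrec half_walk :: "complex \<Rightarrow> complex \<Rightarrow> nat \<Rightarrow> nat \<Rightarrow> complex \<times> complex" where
  "half_walk a b 0 = (\<lambda>j. (if j = 0 then 1 else 0, 0))"
| "half_walk a b (Suc n) = (\<lambda>j.
     (case j of
        0 \<Rightarrow> b * snd (half_walk a b n 0) - cnj a * fst (half_walk a b n 0)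
      | Suc i \<Rightarrow> a * snd (half_walk a b n i) + cnj b * fst (half_walk a b n i),
      b * snd (half_walk a b n (Suc j)) - cnj a * fst (half_walk a b n (Suc j))))"

abbreviation right_amp :: "complex \<Rightarrow> complex \<Rightarrow> nat \<Rightarrow> nat \<Rightarrow> complex" where
  "right_amp a b n j \<equiv> fst (half_walk a b n j)"

abbreviation left_amp :: "complex \<Rightarrow> complex \<Rightarrow> nat \<Rightarrow> nat \<Rightarrow> complex" where
  "left_amp a b n j \<equiv> snd (half_walk a b n j)"

lemma rotation_norm:
  assumes "(cmod a)\<^sup>2 + (cmod b)\<^sup>2 = 1"
  shows "(cmod (b * p - cnj a * q))\<^sup>2 + (cmod (a * p + cnj b * q))\<^sup>2 = (cmod p)\<^sup>2 + (cmod q)\<^sup>2"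
proof -
  have "(cmod (b * p - cnj a * q))\<^sup>2 + (cmod (a * p + cnj b * q))\<^sup>2
      = ((cmod a)\<^sup>2 + (cmod b)\<^sup>2) * ((cmod p)\<^sup>2 + (cmod q)\<^sup>2)"
    unfolding cmod_power2 by (simp add: algebra_simps power2_eq_square)
  then show ?thesis by (simp add: assms)
qed

text \<open>One step moves amplitudes by at most one site, so the mass on \<open>{..J}\<close> after
  the step is bounded by the mass on \<open>{..Suc J}\<close> before it. Finite sums with arbitrary
  \<open>J\<close> keep the induction free of convergence questions.\<close>

lemma half_walk_norm_le:
  assumes "(cmod a)\<^sup>2 + (cmod b)\<^sup>2 = 1"
  shows "(\<Sum>j\<le>J. (cmod (right_amp a b n j))\<^sup>2 + (cmod (left_amp a b n j))\<^sup>2) \<le> 1"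
proof (induction n arbitrary: J)
  case 0
  have "(\<Sum>j\<le>J. (cmod (if j = 0 then 1 else 0))\<^sup>2) = (\<Sum>j\<in>{..J}. if j = 0 then 1 else 0 :: real)"
    by (rule sum.cong) auto
  then show ?case by (simp add: sum.delta)
next
  case (Suc n)
  let ?q = "right_amp a b n" and ?p = "left_amp a b n"
  let ?f = "\<lambda>j. (cmod (b * ?p j - cnj a * ?q j))\<^sup>2" and ?g = "\<lambda>j. (cmod (a * ?p j + cnj b * ?q j))\<^sup>2"
  have "(\<Sum>j\<le>J. (cmod (right_amp a b (Suc n) j))\<^sup>2 + (cmod (left_amp a b (Suc n) j))\<^sup>2)
      = (?f 0 + (\<Sum>j<J. ?g j)) + (\<Sum>j\<le>J. ?f (Suc j))"
    unfolding sum.distrib by (subst sum.atMost_shift) simp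
  also have "\<dots> = (\<Sum>j\<le>Suc J. ?f j) + (\<Sum>j<J. ?g j)"
    by (subst sum.atMost_Suc_shift) simp
  also have "\<dots> \<le> (\<Sum>j\<le>Suc J. ?f j) + (\<Sum>j\<le>Suc J. ?g j)"
    by (intro add_left_mono sum_mono2) auto
  also have "\<dots> = (\<Sum>j\<le>Suc J. (cmod (?q j))\<^sup>2 + (cmod (?p j))\<^sup>2)"
    unfolding sum.distrib[symmetric] rotation_norm[OF assms] by (simp add: add.commute)
  also have "\<dots> \<le> 1" by (rule Suc.IH)
  finally show ?case .
qed

lemma half_walk_amp_le:
  assumes "(cmod a)\<^sup>2 + (cmod b)\<^sup>2 = 1"
  shows "cmod (right_amp a b n j) \<le> 1" "cmod (left_amp a b n j) \<le> 1"
proof -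
  have "(cmod (right_amp a b n j))\<^sup>2 + (cmod (left_amp a b n j))\<^sup>2
      \<le> (\<Sum>j\<le>j. (cmod (right_amp a b n j))\<^sup>2 + (cmod (left_amp a b n j))\<^sup>2)"
    by (rule member_le_sum) auto
  also have "\<dots> \<le> 1" by (rule half_walk_norm_le[OF assms])
  finally have *: "(cmod (right_amp a b n j))\<^sup>2 + (cmod (left_amp a b n j))\<^sup>2 \<le> 1" .
  have "(cmod (right_amp a b n j))\<^sup>2 \<le> 1\<^sup>2" "(cmod (left_amp a b n j))\<^sup>2 \<le> 1\<^sup>2"
    using * zero_le_power2[of "cmod (right_amp a b n j)"] zero_le_power2[of "cmod (left_amp a b n j)"]
    unfolding one_power2 by linarith+
  then show "cmod (right_amp a b n j) \<le> 1" "cmod (left_amp a b n j) \<le> 1"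
    by (auto intro: power2_le_imp_le)
qed

text \<open>\<open>N\<close> and \<open>Y\<close> are the generating functions of the right and left
  amplitudes at site 0, \<open>x\<close> is the series variable and \<open>c\<close> stands for
  \<open>1 / b\<close>. The conclusions are the recursion at the boundary, to the right and to the
  left, under the ansatz that each further site contributes a factor \<open>c * v\<close>. After
  clearing \<open>d\<close>, the two sides differ by multiples of the quadratic equation for
  \<open>v\<close> and of the unitarity relation \<open>a * ac = 1 - w\<close>.\<close>

lemma half_walk_series_identities:
  fixes x v a ac b bc c d w :: "'a::comm_ring_1"
  assumes v: "x * v\<^sup>2 + x * w = (1 + x\<^sup>2) * v" and w: "b * bc = w" "a * ac = 1 - w" and c: "b * c = 1"
    and d: "(1 - x\<^sup>2 - (a - ac) * x) * d = 1"
    and N: "N = (1 - a * x - x * v) * d" and Y: "Y = c * ((x * w - v - ac * x * v) * d)"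
  shows "N = 1 + x * (b * Y - ac * N)"
    and "c * v * N = x * (a * Y + bc * N)"
    and "Y = x * (b * (c * v * Y) - ac * (c * v * N))"
proof -
  have bY: "b * Y = (x * w - v - ac * x * v) * d"
    unfolding Y using c by (metis mult.assoc mult_1)
  have "(1 - x\<^sup>2 - (a - ac) * x) + x * ((x * w - v - ac * x * v) - ac * (1 - a * x - x * v))
      = (1 - a * x - x * v) + x\<^sup>2 * (a * ac - (1 - w))"
    by (simp add: algebra_simps power2_eq_square)
  then have "(1 - a * x - x * v) = (1 - x\<^sup>2 - (a - ac) * x) + x * ((x * w - v - ac * x * v) - ac * (1 - a * x - x * v))"
    unfolding w(2) by simp
  from arg_cong[OF this, of "\<lambda>t. t * d"]
  have "N = (1 - x\<^sup>2 - (a - ac) * x) * d + x * ((x * w - v - ac * x * v) * d - ac * N)"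
    unfolding N by (simp add: algebra_simps)
  then show "N = 1 + x * (b * Y - ac * N)" unfolding d bY .
  have "x * (a * (x * w - v - ac * x * v) + w * (1 - a * x - x * v)) - v * (1 - a * x - x * v)
      = (x * v\<^sup>2 + x * w - (1 + x\<^sup>2) * v) + x\<^sup>2 * v * (1 - w - a * ac)"
    by (simp add: algebra_simps power2_eq_square)
  then have "x * (a * (x * w - v - ac * x * v) + w * (1 - a * x - x * v)) = v * (1 - a * x - x * v)"
    unfolding v w(2) by simp
  from arg_cong[OF this, of "\<lambda>t. t * d"] have "x * (a * (b * Y) + w * N) = v * N"
    unfolding bY N by (simp add: algebra_simps)
  from arg_cong[OF this, of "\<lambda>t. c * t"]
  have "c * v * N = x * ((b * c) * (a * Y) + (b * c) * (bc * N))"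
    unfolding w(1)[symmetric] by (simp add: algebra_simps)
  then show "c * v * N = x * (a * Y + bc * N)" unfolding c by simp
  have "x * v * (x * w - v - ac * x * v - ac * (1 - a * x - x * v)) - (x * w - v - ac * x * v)
      = - (x * v\<^sup>2 + x * w - (1 + x\<^sup>2) * v) - x\<^sup>2 * v * (1 - w - a * ac)"
    by (simp add: algebra_simps power2_eq_square)
  then have "x * v * (x * w - v - ac * x * v - ac * (1 - a * x - x * v)) = x * w - v - ac * x * v"
    unfolding v w(2) by simp
  from arg_cong[OF this, of "\<lambda>t. c * (t * d)"] have "c * (x * v * (b * Y - ac * N)) = c * (b * Y)"
    unfolding bY N by (simp add: algebra_simps)
  also have "\<dots> = (b * c) * Y" by (simp add: mult_ac)
  finally have "c * (x * v * (b * Y - ac * N)) = Y" unfolding c by simp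
  then show "Y = x * (b * (c * v * Y) - ac * (c * v * N))"
    by (simp add: algebra_simps)
qed

lemma unit_pair_le: "p\<^sup>2 + q\<^sup>2 = 1 \<Longrightarrow> p \<le> 1" for p q :: real
  using zero_le_power2[of q] by (intro power2_le_imp_le[of p 1]) (unfold one_power2, linarith+)

text \<open>For \<open>a \<noteq> 0\<close>, eliminating the left amplitudes gives
  \<open>a / (a + z - V)\<close> at site 0. The quadratic equation turns
  \<open>(a + z - V) * (1 - a * z - z * V)\<close> into
  \<open>a * (1 - z ^ 2 - (a - cnj a) * z)\<close>, so this form has a polynomial denominator and
  its two poles are explicit.\<close>

definition right_series :: "complex \<Rightarrow> complex \<Rightarrow> nat \<Rightarrow> complex fps" where
  "right_series a b j = fps_const (1 / b ^ j) * ((decay_fps (cmod b) ^ j *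
     (1 - fps_const a * fps_X - fps_X * decay_fps (cmod b))) * inverse (1 - fps_X ^ 2 - fps_const (a - cnj a) * fps_X))"

text \<open>The series satisfy the recursion of the walk. Each equation carries a factor
  \<open>fps_X\<close>, so it yields coefficient \<open>Suc n\<close> from the coefficients at
  \<open>n\<close>, and its constant coefficient is the initial state.\<close>

lemma right_amp_eq_series:
  assumes ab: "(cmod a)\<^sup>2 + (cmod b)\<^sup>2 = 1" and b: "b \<noteq> 0"
  shows "right_amp a b n j = fps_nth (right_series a b j) n"
proof -
  let ?c = "fps_const (1/b)" and ?v = "decay_fps (cmod b)"
  define d where "d = inverse (1 - fps_X ^ 2 - fps_const (a - cnj a) * fps_X)"
  define N where "N = (1 - fps_const a * fps_X - fps_X * ?v) * d"
  define Y where "Y = ?c * ((fps_X * fps_const (of_real (cmod b) ^ 2) - ?v - fps_const (cnj a) * fps_X * ?v) * d)"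
  have b1: "cmod b \<le> 1"
    using unit_pair_le[of "cmod b" "cmod a"] ab by (simp add: add.commute)
  have 1: "fps_const b * fps_const (cnj b) = fps_const (of_real (cmod b) ^ 2)"
    using complex_norm_square[of b] by simp
  have "a * cnj a = 1 - of_real (cmod b) ^ 2"
    using complex_norm_square[of a] ab by (metis add_diff_cancel_right' of_real_1 of_real_diff of_real_power)
  then have 2: "fps_const a * fps_const (cnj a) = 1 - fps_const (of_real (cmod b) ^ 2)"
    by (simp flip: fps_const_sub)
  have 3: "(1 - fps_X\<^sup>2 - (fps_const a - fps_const (cnj a)) * fps_X) * d = 1"
    unfolding d_def fps_const_sub by (rule inverse_mult_eq_1') simp
  have 4: "fps_const b * ?c = 1" using b by simp
  note ids = half_walk_series_identities[OF decay_fps_quadratic[OF norm_ge_zero b1] 1 2 4 3 N_def Y_def]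
  define Q where "Q j = (?c * ?v) ^ j * N" for j
  define P where "P j = (?c * ?v) ^ j * Y" for j
  have Q0: "Q 0 = 1 + fps_X * (fps_const b * P 0 - fps_const (cnj a) * Q 0)"
    using ids(1) by (simp add: Q_def P_def)
  have QS: "Q (Suc i) = fps_X * (fps_const a * P i + fps_const (cnj b) * Q i)" for i
    using arg_cong[OF ids(2), of "(*) ((?c * ?v) ^ i)"]
    by (simp only: Q_def P_def power_Suc ring_distribs mult_ac)
  have PS: "P i = fps_X * (fps_const b * P (Suc i) - fps_const (cnj a) * Q (Suc i))" for i
    using arg_cong[OF ids(3), of "(*) ((?c * ?v) ^ i)"]
    by (simp only: Q_def P_def power_Suc ring_distribs mult_ac)
  have "half_walk a b n j = (fps_nth (Q j) n, fps_nth (P j) n)" for n j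
  proof (induction n arbitrary: j)
    case 0
    have "fps_nth (P j) 0 = 0" by (subst PS) simp
    moreover have "fps_nth (Q 0) 0 = 1" by (subst Q0) simp
    moreover have "fps_nth (Q (Suc i)) 0 = 0" for i by (subst QS) simp
    ultimately show ?case by (cases j) auto
  next
    case (Suc n)
    have "fps_nth (P j) (Suc n) = b * fps_nth (P (Suc j)) n - cnj a * fps_nth (Q (Suc j)) n"
      by (subst PS) simp
    moreover have "fps_nth (Q 0) (Suc n) = b * fps_nth (P 0) n - cnj a * fps_nth (Q 0) n"
      by (subst Q0) simp
    moreover have "fps_nth (Q (Suc i)) (Suc n) = a * fps_nth (P i) n + cnj b * fps_nth (Q i) n" for i
      by (subst QS) simp
    ultimately show ?case using Suc by (cases j) auto
  qed
  moreover have "Q j = right_series a b j"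
    by (simp add: Q_def N_def d_def right_series_def power_mult_distrib fps_const_power mult_ac power_divide)
  ultimately show ?thesis by simp
qed

section \<open>Asymptotics of the half-line walk\<close>

definition fps_tail :: "real fps \<Rightarrow> nat \<Rightarrow> real" where
  "fps_tail D n = (\<Sum>m. fps_nth D (m + Suc n))"

lemma fps_tail_tendsto_0:
  assumes "abs_summable D"
  shows "fps_tail D \<longlonglongrightarrow> 0"
proof -
  have "summable (fps_nth D)"
    using assms unfolding abs_summable_def by (rule summable_norm_cancel)
  then have "(\<lambda>n. \<Sum>m. fps_nth D (m + n)) \<longlonglongrightarrow> 0" by (rule suminf_exist_split2)
  then show ?thesis
    unfolding fps_tail_def by (rule LIMSEQ_Suc)
qed

abbreviation geometric_fps :: "complex \<Rightarrow> complex fps" where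
  "geometric_fps l \<equiv> Abs_fps (\<lambda>n. l ^ n)"

lemma geometric_fps_inverse: "geometric_fps l * (1 - fps_const l * fps_X) = 1"
proof (rule fps_ext)
  fix n
  have "fps_nth (geometric_fps l * (1 - fps_const l * fps_X)) n
      = fps_nth (geometric_fps l) n - fps_nth (fps_const l * (geometric_fps l * fps_X)) n"
    by (simp add: algebra_simps)
  then show "fps_nth (geometric_fps l * (1 - fps_const l * fps_X)) n = fps_nth 1 n"
    by (cases n) (auto simp: fps_mult_right_const_nth)
qed

text \<open>The coefficient is a convolution, that is, \<open>l ^ n\<close> times the partial sum
  through index \<open>n\<close> of the series at \<open>cnj l\<close>, the inverse of
  \<open>l\<close>. What is missing starts at \<open>Suc n\<close> and is bounded through
  \<open>D\<close>, whatever \<open>l\<close> is.\<close>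

lemma geometric_mult_asymptotics:
  assumes f: "majorized f D" "abs_summable D" and l: "norm l = 1"
  shows "norm (fps_nth (f * geometric_fps l) n - l ^ n * fps_sum f (cnj l)) \<le> fps_tail D n"
proof -
  let ?g = "\<lambda>m. fps_nth f m * cnj l ^ m"
  have ll: "l * cnj l = 1" using complex_norm_square[of l] l by simp
  have s: "summable ?g"
    by (rule fps_sum_summable) (use majorized_abs_summable[OF f] l in auto)
  have "fps_nth (f * geometric_fps l) n = (\<Sum>m\<le>n. fps_nth f m * l ^ (n - m))"
    by (simp add: fps_mult_nth atLeast0AtMost)
  also have "\<dots> = l ^ n * (\<Sum>m\<le>n. ?g m)"
    unfolding sum_distrib_left
  proof (rule sum.cong)
    fix m assume "m \<in> {..n}"
    then have "l ^ n * cnj l ^ m = l ^ (n - m) * (l * cnj l) ^ m"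
      by (simp add: power_mult_distrib flip: power_add mult.assoc)
    then show "fps_nth f m * l ^ (n - m) = l ^ n * ?g m" by (simp add: ll)
  qed simp
  finally have "fps_nth (f * geometric_fps l) n - l ^ n * fps_sum f (cnj l) = - (l ^ n * (\<Sum>m. ?g (m + Suc n)))"
    unfolding fps_sum_def suminf_split_initial_segment[OF s, of "Suc n"]
    by (simp add: algebra_simps lessThan_Suc_atMost)
  then have "norm (fps_nth (f * geometric_fps l) n - l ^ n * fps_sum f (cnj l)) = norm (\<Sum>m. ?g (m + Suc n))"
    using l by (simp add: norm_mult norm_power)
  also have "\<dots> \<le> fps_tail D n"
    unfolding fps_tail_def
  proof (rule norm_suminf_le)
    show "norm (?g (m + Suc n)) \<le> fps_nth D (m + Suc n)" for m
      using f(1) l by (simp add: norm_mult norm_power majorized_def)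
    show "summable (\<lambda>m. fps_nth D (m + Suc n))"
      using f(2) unfolding abs_summable_def by (subst summable_iff_shift) (rule summable_norm_cancel)
  qed
  finally show ?thesis .
qed

text \<open>Partial fractions reduce the claim to two geometric factors. The distance of the poles
  stays in the bound as it depends on the momentum.\<close>

lemma two_pole_asymptotics:
  assumes f: "majorized f D" "abs_summable D" and l: "norm l1 = 1" "norm l2 = 1" "l1 \<noteq> l2"
  shows "norm (fps_nth (f * inverse ((1 - fps_const l1 * fps_X) * (1 - fps_const l2 * fps_X))) n
     - (l1 ^ Suc n * fps_sum f (cnj l1) - l2 ^ Suc n * fps_sum f (cnj l2)) / (l1 - l2))
     \<le> 2 * fps_tail D n / norm (l1 - l2)"
proof -
  let ?D = "(1 - fps_const l1 * fps_X) * (1 - fps_const l2 * fps_X)"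
  let ?J = "fps_const (l1 / (l1 - l2)) * geometric_fps l1 - fps_const (l2 / (l1 - l2)) * geometric_fps l2"
  have swap: "(C1 * G1 - C2 * G2) * (A1 * A2) = C1 * A2 * (G1 * A1) - C2 * A1 * (G2 * A2)"
    for A1 A2 C1 C2 G1 G2 :: "complex fps"
    by (simp add: algebra_simps)
  have "?J * ?D = fps_const (l1 / (l1 - l2)) * (1 - fps_const l2 * fps_X) * (geometric_fps l1 * (1 - fps_const l1 * fps_X))
     - fps_const (l2 / (l1 - l2)) * (1 - fps_const l1 * fps_X) * (geometric_fps l2 * (1 - fps_const l2 * fps_X))"
    by (rule swap)
  also have "\<dots> = fps_const (l1 / (l1 - l2)) * (1 - fps_const l2 * fps_X) - fps_const (l2 / (l1 - l2)) * (1 - fps_const l1 * fps_X)"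
    by (simp add: geometric_fps_inverse)
  also have "\<dots> = fps_const (l1 / (l1 - l2) - l2 / (l1 - l2))"
    by (simp add: algebra_simps flip: fps_const_sub mult.assoc)
  also have "\<dots> = 1" using l(3) by (simp flip: diff_divide_distrib)
  finally have "?D * ?J = 1" by (subst mult.commute)
  then have "?J = inverse ?D" by (rule fps_inverse_unique[symmetric])
  then have "f * inverse ?D = fps_const (l1 / (l1 - l2)) * (f * geometric_fps l1) - fps_const (l2 / (l1 - l2)) * (f * geometric_fps l2)"
    by (simp add: algebra_simps)
  then have "fps_nth (f * inverse ?D) n = (l1 * fps_nth (f * geometric_fps l1) n - l2 * fps_nth (f * geometric_fps l2) n) / (l1 - l2)"
    by (simp add: diff_divide_distrib del: fps_mult_nth)
  then have "norm (fps_nth (f * inverse ?D) n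
     - (l1 ^ Suc n * fps_sum f (cnj l1) - l2 ^ Suc n * fps_sum f (cnj l2)) / (l1 - l2))
     = norm ((l1 * (fps_nth (f * geometric_fps l1) n - l1 ^ n * fps_sum f (cnj l1))
        - l2 * (fps_nth (f * geometric_fps l2) n - l2 ^ n * fps_sum f (cnj l2))) / (l1 - l2))"
    by (simp add: algebra_simps flip: diff_divide_distrib add_divide_distrib)
  also have "\<dots> \<le> (norm (l1 * (fps_nth (f * geometric_fps l1) n - l1 ^ n * fps_sum f (cnj l1)))
       + norm (l2 * (fps_nth (f * geometric_fps l2) n - l2 ^ n * fps_sum f (cnj l2)))) / norm (l1 - l2)"
    unfolding norm_divide by (intro divide_right_mono norm_triangle_ineq4) auto
  also have "\<dots> \<le> (fps_tail D n + fps_tail D n) / norm (l1 - l2)"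
    using l geometric_mult_asymptotics[OF f l(1), of n] geometric_mult_asymptotics[OF f l(2), of n]
    by (intro divide_right_mono add_mono) (auto simp: norm_mult)
  finally show ?thesis by simp
qed

text \<open>Majorizes the numerator of \<open>right_series\<close> for all momenta at once;
  \<open>fps_const 1\<close> takes the place of \<open>a\<close>, whose modulus is at most
  1.\<close>

definition amp_majorant :: "nat \<Rightarrow> real fps" where
  "amp_majorant j = decay_majorant ^ j * (1 + fps_const 1 * fps_X + fps_X * decay_majorant)"

lemma abs_summable_amp_majorant: "abs_summable (amp_majorant j)"
  unfolding amp_majorant_def by (intro abs_summable_intros abs_summable_decay_majorant)

text \<open>The limit is the contribution of the bound state: \<open>bound_eigenvalue a\<close> is its eigenvalue,
  \<open>bound_decay a / b\<close> the ratio of its consecutive components, and \<open>bound_weight a\<close> the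
  squared modulus of its first component after normalisation.\<close>

definition gap :: "complex \<Rightarrow> real" where
  "gap a = sqrt (1 - (Im a)\<^sup>2)"

definition bound_eigenvalue :: "complex \<Rightarrow> complex" where
  "bound_eigenvalue a = Complex (- sgn (Re a) * gap a) (Im a)"

definition bound_decay :: "complex \<Rightarrow> real" where
  "bound_decay a = Re a - sgn (Re a) * gap a"

definition bound_weight :: "complex \<Rightarrow> real" where
  "bound_weight a = \<bar>Re a\<bar> / gap a"

lemma right_amp_asymptotics:
  assumes ab: "(cmod a)\<^sup>2 + (cmod b)\<^sup>2 = 1" and b: "b \<noteq> 0" and a: "Re a \<noteq> 0"
  shows "norm (right_amp a b n j - of_real (bound_weight a) * bound_eigenvalue a ^ n * (of_real (bound_decay a) / b) ^ j)
     \<le> fps_tail (amp_majorant j) n / (gap a * norm b ^ j)"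
proof -
  define c y w where "c = Re a" and "y = Im a" and "w = gap a"
  have c0: "c \<noteq> 0" and aeq: "a = Complex c y" using a by (auto simp: c_def y_def)
  have cyb: "c\<^sup>2 + y\<^sup>2 + (cmod b)\<^sup>2 = 1" using ab by (simp add: cmod_power2 c_def y_def)
  have B: "0 \<le> cmod b" "cmod b \<le> 1"
  proof -
    have "(cmod b)\<^sup>2 \<le> 1\<^sup>2" using cyb zero_le_power2[of c] zero_le_power2[of y]
      unfolding one_power2 by linarith
    then show "cmod b \<le> 1" by (rule power2_le_imp_le) simp
  qed simp
  have w2: "w\<^sup>2 = c\<^sup>2 + (cmod b)\<^sup>2" 
    unfolding w_def gap_def using cyb zero_le_power2[of c] zero_le_power2[of "cmod b"] unfolding y_def[symmetric]
    by (subst real_sqrt_pow2) linarith+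
  have w0: "w > 0"
    unfolding w_def gap_def real_sqrt_gt_0_iff using cyb c0 zero_less_power2[of c] zero_le_power2[of "cmod b"]
    unfolding y_def[symmetric] by linarith
  \<comment> \<open>The inverses of the two poles: they have sum \<open>a - cnj a\<close> and
    product \<open>-1\<close>, hence modulus 1 and imaginary part \<open>Im a\<close>. The signs are
    chosen so that the residue survives at \<open>l1\<close>.\<close>
  define l1 l2 where "l1 = Complex (- sgn c * w) y" and "l2 = Complex (sgn c * w) y"
  have sc: "sgn c * sgn c = 1" using c0 by (simp add: sgn_if)
  have n1: "norm l1 = 1" "norm l2 = 1"
    using w2 cyb sc by (auto simp: l1_def l2_def cmod_def power_mult_distrib power2_eq_square[of "sgn c"])
  have dl: "l1 - l2 = of_real (- 2 * sgn c * w)"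
    by (simp add: l1_def l2_def complex_eq_iff)
  have ne: "l1 \<noteq> l2"
    using w0 c0 by (auto simp: l1_def l2_def sgn_if)
  have nd: "norm (l1 - l2) = 2 * w"
    unfolding dl norm_of_real using w0 c0 by (simp add: abs_mult sgn_if)
  have Re2: "(Re l1)\<^sup>2 = (cmod b)\<^sup>2 + c\<^sup>2" "(Re l2)\<^sup>2 = (cmod b)\<^sup>2 + c\<^sup>2"
    using sc by (auto simp: l1_def l2_def power_mult_distrib power2_eq_square[of "sgn c"] w2)
  have Rn: "Re l1 \<noteq> 0" "Re l2 \<noteq> 0" using w0 c0 by (auto simp: l1_def l2_def sgn_if)
  let ?V = "decay_fps (cmod b)"
  define f where "f = ?V ^ j * (1 - fps_const a * fps_X - fps_X * ?V)"
  have na: "norm a \<le> 1"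
    using unit_pair_le[of "cmod a" "cmod b"] ab by simp
  have maj: "majorized f (amp_majorant j)"
    unfolding f_def amp_majorant_def
    by (intro majorized_mult majorized_power majorized_diff majorized_one majorized_const majorized_X
        majorized_decay_fps B na)
  have sum_f: "fps_sum f (cnj l) = fps_sum ?V (cnj l) ^ j * (cnj l * (l - a - fps_sum ?V (cnj l)))" if "norm l = 1" for l
  proof -
    have "cnj l * l = 1" using complex_norm_square[of l] that by (simp add: mult.commute)
    then show ?thesis
      unfolding f_def using that B
      by (simp add: fps_sum_simps abs_summable_intros abs_summable_decay_fps algebra_simps)
  qed
  have V1: "fps_sum ?V (cnj l1) = of_real (c - sgn c * w)"
    unfolding fps_sum_decay_fps[OF B n1(1) Re2(1) Rn(1)] using w0 c0
    by (auto simp: l1_def sgn_if mult_less_0_iff zero_less_mult_iff)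
  have V2: "fps_sum ?V (cnj l2) = of_real (sgn c * w - c)"
    unfolding fps_sum_decay_fps[OF B n1(2) Re2(2) Rn(2)] using w0 c0
    by (auto simp: l2_def sgn_if mult_less_0_iff zero_less_mult_iff)
  \<comment> \<open>The decaying root takes the value \<open>l2 - a\<close> at this pole, so the
    numerator \<open>cnj l2 * (l2 - a - V)\<close> vanishes there.\<close>
  have F2: "fps_sum f (cnj l2) = 0"
    unfolding sum_f[OF n1(2)] V2 by (simp add: l2_def aeq complex_eq_iff)
  have "l1 - a - fps_sum ?V (cnj l1) = of_real (- 2 * c)"
    unfolding V1 by (simp add: l1_def aeq complex_eq_iff)
  then have F1: "fps_sum f (cnj l1) = of_real (c - sgn c * w) ^ j * (cnj l1 * of_real (- 2 * c))"
    unfolding sum_f[OF n1(1)] V1[symmetric] by (simp only:)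
  have l1c: "l1 * cnj l1 = 1" using complex_norm_square[of l1] n1 by simp
  have "l1 ^ Suc n * fps_sum f (cnj l1) = (l1 * cnj l1) * l1 ^ n * of_real (c - sgn c * w) ^ j * of_real (- 2 * c)"
    unfolding F1 by (simp add: mult_ac)
  then have lead: "(l1 ^ Suc n * fps_sum f (cnj l1) - l2 ^ Suc n * fps_sum f (cnj l2)) / (l1 - l2)
      = of_real (\<bar>c\<bar> / w) * l1 ^ n * of_real (c - sgn c * w) ^ j"
  proof -
    assume *: "l1 ^ Suc n * fps_sum f (cnj l1) = (l1 * cnj l1) * l1 ^ n * of_real (c - sgn c * w) ^ j * of_real (- 2 * c)"
    have **: "- 2 * c / (- 2 * sgn c * w) = \<bar>c\<bar> / w"
      using c0 by (auto simp: sgn_if)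
    have "(l1 ^ Suc n * fps_sum f (cnj l1) - l2 ^ Suc n * fps_sum f (cnj l2)) / (l1 - l2)
       = l1 ^ n * of_real (c - sgn c * w) ^ j * (of_real (- 2 * c) / of_real (- 2 * sgn c * w))"
      unfolding * F2 l1c dl by simp
    also have "of_real (- 2 * c) / of_real (- 2 * sgn c * w) = (of_real (\<bar>c\<bar> / w) :: complex)"
      unfolding of_real_divide[symmetric] ** ..
    finally show ?thesis by (simp add: mult_ac)
  qed
  have "l1 + l2 = a - cnj a" by (simp add: l1_def l2_def aeq complex_eq_iff)
  moreover have "l1 * l2 = -1"
    using n1 by (simp add: l1_def l2_def complex_eq_iff cmod_def power2_eq_square)
  ultimately have D: "(1 - fps_const l1 * fps_X) * (1 - fps_const l2 * fps_X)
      = 1 - fps_X ^ 2 - fps_const (a - cnj a) * fps_X"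
  proof -
    assume s: "l1 + l2 = a - cnj a" and p: "l1 * l2 = -1"
    have "(1 - fps_const l1 * fps_X) * (1 - fps_const l2 * fps_X)
       = 1 + fps_const (l1 * l2) * fps_X ^ 2 - fps_const (l1 + l2) * fps_X"
      by (simp add: algebra_simps power2_eq_square flip: fps_const_mult fps_const_add)
    then show ?thesis unfolding s p by (simp flip: fps_const_neg)
  qed
  have "right_amp a b n j = 1 / b ^ j * fps_nth (f * inverse ((1 - fps_const l1 * fps_X) * (1 - fps_const l2 * fps_X))) n"
    unfolding right_amp_eq_series[OF ab b] right_series_def D f_def[symmetric] by (rule fps_mult_left_const_nth)
  then have "right_amp a b n j - of_real (\<bar>c\<bar> / w) * l1 ^ n * (of_real (c - sgn c * w) / b) ^ j
     = 1 / b ^ j * (fps_nth (f * inverse ((1 - fps_const l1 * fps_X) * (1 - fps_const l2 * fps_X))) n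
         - (l1 ^ Suc n * fps_sum f (cnj l1) - l2 ^ Suc n * fps_sum f (cnj l2)) / (l1 - l2))"
    unfolding lead power_divide by (simp add: algebra_simps diff_divide_distrib)
  then have "norm (right_amp a b n j - of_real (\<bar>c\<bar> / w) * l1 ^ n * (of_real (c - sgn c * w) / b) ^ j)
     \<le> 1 / norm b ^ j * (2 * fps_tail (amp_majorant j) n / norm (l1 - l2))"
    using two_pole_asymptotics[OF maj abs_summable_amp_majorant n1 ne]
    by (simp only: norm_mult norm_divide norm_power norm_one) (intro mult_left_mono, auto)
  also have "\<dots> = fps_tail (amp_majorant j) n / (w * norm b ^ j)"
    unfolding nd by simp
  finally show ?thesis
    by (simp only: bound_weight_def bound_eigenvalue_def bound_decay_def w_def c_def y_def l1_def)
qed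

text \<open>Solving the recursion of the right-moving amplitudes for the left-moving ones gives their
  asymptotics without a second residue computation.\<close>

lemma left_amp_asymptotics:
  assumes ab: "(cmod a)\<^sup>2 + (cmod b)\<^sup>2 = 1" and b: "b \<noteq> 0" and a: "Re a \<noteq> 0"
  shows "norm (left_amp a b n j - of_real (bound_weight a) * bound_eigenvalue a ^ n * (of_real (bound_decay a) / b) ^ Suc j)
     \<le> (fps_tail (amp_majorant (Suc j)) (Suc n) / (gap a * norm b ^ Suc j)
        + norm b * (fps_tail (amp_majorant j) n / (gap a * norm b ^ j))) / norm a"
proof -
  define h l u where "h = complex_of_real (bound_weight a)" and "l = bound_eigenvalue a"
    and "u = complex_of_real (bound_decay a)"
  have a0: "a \<noteq> 0" using a by auto
  have "(gap a)\<^sup>2 = (Re a)\<^sup>2 + (cmod b)\<^sup>2"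
    unfolding gap_def using ab zero_le_power2[of "Re a"] zero_le_power2[of "cmod b"]
    unfolding cmod_power2[of a] by (subst real_sqrt_pow2) linarith+
  moreover have "(sgn (Re a))\<^sup>2 = 1" using a by (simp add: sgn_if)
  \<comment> \<open>This is \<open>(l - a) * u = norm b ^ 2\<close>, the eigenvalue equation of the
    bound state for the step to the right. It shows that its left component at \<open>j\<close>
    equals its right component at \<open>Suc j\<close>.\<close>
  ultimately have bb: "(- sgn (Re a) * gap a - Re a) * (Re a - sgn (Re a) * gap a) = (cmod b)\<^sup>2"
    by (simp add: algebra_simps power2_eq_square)
  have "l - a = of_real (- sgn (Re a) * gap a - Re a)"
    by (simp add: l_def bound_eigenvalue_def complex_eq_iff)
  then have "(l - a) * u = b * cnj b"
    unfolding u_def bound_decay_def by (simp only: of_real_mult[symmetric] bb complex_norm_square)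
  then have ev: "l * (u / b) - cnj b = a * (u / b)" using b by (simp add: field_simps)
  have "right_amp a b (Suc n) (Suc j) = a * left_amp a b n j + cnj b * right_amp a b n j"
    by simp
  then have "left_amp a b n j = (right_amp a b (Suc n) (Suc j) - cnj b * right_amp a b n j) / a"
    using a0 by (simp add: field_simps)
  moreover have "h * l ^ n * (u / b) ^ Suc j
      = (h * l ^ Suc n * (u / b) ^ Suc j - cnj b * (h * l ^ n * (u / b) ^ j)) / a"
  proof -
    have "h * l ^ Suc n * (u / b) ^ Suc j - cnj b * (h * l ^ n * (u / b) ^ j)
       = h * l ^ n * (u / b) ^ j * (l * (u / b) - cnj b)" by (simp add: algebra_simps)
    then show ?thesis using a0 unfolding ev by (simp add: field_simps)
  qed
  ultimately have "left_amp a b n j - h * l ^ n * (u / b) ^ Suc j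
    = ((right_amp a b (Suc n) (Suc j) - h * l ^ Suc n * (u / b) ^ Suc j)
       - cnj b * (right_amp a b n j - h * l ^ n * (u / b) ^ j)) / a"
    by (simp only: diff_divide_distrib right_diff_distrib) simp
  then have "norm (left_amp a b n j - h * l ^ n * (u / b) ^ Suc j)
    \<le> (norm (right_amp a b (Suc n) (Suc j) - h * l ^ Suc n * (u / b) ^ Suc j)
       + norm b * norm (right_amp a b n j - h * l ^ n * (u / b) ^ j)) / norm a"
    using norm_triangle_ineq4[of "right_amp a b (Suc n) (Suc j) - h * l ^ Suc n * (u / b) ^ Suc j"
        "cnj b * (right_amp a b n j - h * l ^ n * (u / b) ^ j)"]
    by (simp only: norm_divide norm_mult complex_mod_cnj) (rule divide_right_mono, auto)
  also have "\<dots> \<le> (fps_tail (amp_majorant (Suc j)) (Suc n) / (gap a * norm b ^ Suc j)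
        + norm b * (fps_tail (amp_majorant j) n / (gap a * norm b ^ j))) / norm a"
    unfolding h_def l_def u_def
    by (intro divide_right_mono add_mono mult_left_mono right_amp_asymptotics ab a b) auto
  finally show ?thesis unfolding h_def l_def u_def .
qed

definition site_amp :: "complex \<Rightarrow> complex \<Rightarrow> nat \<Rightarrow> nat \<Rightarrow> complex" where
  "site_amp a b n k = (if even k then right_amp a b n (k div 2) else left_amp a b n (k div 2))"

text \<open>Odd sites carry one more factor of decay, because the left component of the bound state
  at \<open>j\<close> coincides with its right component at \<open>j + 1\<close>.\<close>

definition site_exponent :: "nat \<Rightarrow> nat" where
  "site_exponent k = (if even k then k div 2 else k div 2 + 1)"

definition bound_site :: "complex \<Rightarrow> complex \<Rightarrow> nat \<Rightarrow> complex" where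
  "bound_site a b k = of_real (bound_weight a) * (of_real (bound_decay a) / b) ^ site_exponent k"

lemma site_amp_le:
  assumes "(cmod a)\<^sup>2 + (cmod b)\<^sup>2 = 1"
  shows "cmod (site_amp a b n k) \<le> 1"
  using half_walk_amp_le[OF assms] by (simp add: site_amp_def)

text \<open>The coin parameters may change with \<open>n\<close>, as they do for the momentum
  \<open>k - t / n\<close>. The error bounds involve them only through \<open>gap\<close>,
  \<open>norm a\<close> and \<open>norm b\<close>, which stay away from 0 near the limit, while the
  tails tend to 0 independently of them.\<close>

lemma site_amp_limit:
  fixes a b :: "nat \<Rightarrow> complex"
  assumes ab: "\<And>n. (cmod (a n))\<^sup>2 + (cmod (b n))\<^sup>2 = 1"
    and lim: "a \<longlonglongrightarrow> a0" "b \<longlonglongrightarrow> b0" and nz: "Re a0 \<noteq> 0" "b0 \<noteq> 0" and gap: "gap a0 \<noteq> 0"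
  shows "(\<lambda>n. site_amp (a n) (b n) n k - bound_site (a n) (b n) k * bound_eigenvalue (a n) ^ n) \<longlonglongrightarrow> 0"
proof -
  have "a0 \<noteq> 0" using nz by auto
  have ga: "(\<lambda>n. gap (a n)) \<longlonglongrightarrow> gap a0" unfolding gap_def by (intro tendsto_intros lim)
  have ev: "\<forall>\<^sub>F n in sequentially. Re (a n) \<noteq> 0 \<and> b n \<noteq> 0"
    by (intro eventually_conj tendsto_imp_eventually_ne[OF tendsto_Re[OF lim(1)] nz(1)]
        tendsto_imp_eventually_ne[OF lim(2) nz(2)])
  note t0 = fps_tail_tendsto_0[OF abs_summable_amp_majorant]
  let ?E = "\<lambda>j n. fps_tail (amp_majorant j) n / (gap (a n) * norm (b n) ^ j)"
  let ?L = "\<lambda>j n. (fps_tail (amp_majorant (Suc j)) (Suc n) / (gap (a n) * norm (b n) ^ Suc j)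
        + norm (b n) * (fps_tail (amp_majorant j) n / (gap (a n) * norm (b n) ^ j))) / norm (a n)"
  have E: "?E j \<longlonglongrightarrow> 0" for j
    using tendsto_divide[OF t0 tendsto_mult[OF ga tendsto_power[OF tendsto_norm[OF lim(2)]]], of j j]
      gap nz by simp
  have S: "(\<lambda>n. fps_tail (amp_majorant (Suc j)) (Suc n) / (gap (a n) * norm (b n) ^ Suc j)) \<longlonglongrightarrow> 0" for j
    using tendsto_divide[OF LIMSEQ_Suc[OF t0] tendsto_mult[OF ga tendsto_power[OF tendsto_norm[OF lim(2)]]], of "Suc j" "Suc j"]
      gap nz by simp
  have L: "?L j \<longlonglongrightarrow> 0" for j
    using tendsto_divide[OF tendsto_add[OF S tendsto_mult[OF tendsto_norm[OF lim(2)] E]] tendsto_norm[OF lim(1)], of j j]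
      \<open>a0 \<noteq> 0\<close> by simp
  show ?thesis
  proof (cases "even k")
    case True
    show ?thesis
      by (rule Lim_null_comparison[OF _ E[of "k div 2"]], rule eventually_mono[OF ev])
         (use True right_amp_asymptotics[OF ab] in \<open>auto simp: site_amp_def bound_site_def site_exponent_def mult_ac\<close>)
  next
    case False
    show ?thesis
      by (rule Lim_null_comparison[OF _ L[of "k div 2"]], rule eventually_mono[OF ev])
         (use False left_amp_asymptotics[OF ab] in \<open>auto simp: site_amp_def bound_site_def site_exponent_def mult_ac\<close>)
  qed
qed

section \<open>Fourier transform of the walk\<close>

text \<open>At each time the walk has finite support along the second coordinate, so this is a
  trigonometric polynomial; for infinite support the sum is 0 by convention.\<close>

definition hat :: "(int \<Rightarrow> complex) \<Rightarrow> real \<Rightarrow> complex" where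
  "hat f k = (\<Sum>m | f m \<noteq> 0. f m * cis (- k * of_int m))"

lemma hat_eq:
  assumes "finite A" "{m. f m \<noteq> 0} \<subseteq> A"
  shows "hat f k = (\<Sum>m\<in>A. f m * cis (- k * of_int m))"
  unfolding hat_def by (rule sum.mono_neutral_left) (use assms in auto)

lemma hat_lincomb:
  assumes "finite {m. f m \<noteq> 0}" "finite {m. g m \<noteq> 0}"
  shows "hat (\<lambda>m. u * f m + v * g m) k = u * hat f k + v * hat g k"
proof -
  let ?A = "{m. f m \<noteq> 0} \<union> {m. g m \<noteq> 0}"
  have "hat (\<lambda>m. u * f m + v * g m) k = (\<Sum>m\<in>?A. (u * f m + v * g m) * cis (- k * of_int m))"
    by (rule hat_eq) (use assms in auto)
  also have "\<dots> = u * (\<Sum>m\<in>?A. f m * cis (- k * of_int m)) + v * (\<Sum>m\<in>?A. g m * cis (- k * of_int m))"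
    by (simp add: sum.distrib sum_distrib_left distrib_right mult.assoc)
  also have "\<dots> = u * hat f k + v * hat g k"
    using assms by (simp add: hat_eq[of ?A])
  finally show ?thesis .
qed

lemma finite_support_translate:
  fixes f :: "int \<Rightarrow> complex"
  assumes "finite {m. f m \<noteq> 0}"
  shows "finite {m. f (m + t) \<noteq> 0}"
proof -
  have "{m. f (m + t) \<noteq> 0} = (\<lambda>m. m - t) ` {m. f m \<noteq> 0}"
    by (force simp: image_iff intro: exI[of _ "_ + t"])
  then show ?thesis using assms by simp
qed

lemma hat_translate: "hat (\<lambda>m. f (m + t)) k = cis (k * of_int t) * hat f k"
proof -
  have "hat (\<lambda>m. f (m + t)) k = (\<Sum>m | f m \<noteq> 0. f m * cis (- k * of_int (m - t)))"
    unfolding hat_def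
    by (rule sum.reindex_bij_witness[where i = "\<lambda>m. m - t" and j = "\<lambda>m. m + t"]) auto
  also have "\<dots> = cis (k * of_int t) * hat f k"
    unfolding hat_def sum_distrib_left
    by (rule sum.cong) (auto simp: algebra_simps cis_mult)
  finally show ?thesis .
qed

section \<open>The double step in momentum space\<close>

definition coin_a :: "real \<Rightarrow> real \<Rightarrow> real \<Rightarrow> complex" where
  "coin_a \<alpha> \<beta> k = of_real (sin \<alpha> * cos \<beta>) * cis k + of_real (cos \<alpha> * sin \<beta>) * cis (- k)"

definition coin_b :: "real \<Rightarrow> real \<Rightarrow> real \<Rightarrow> complex" where
  "coin_b \<alpha> \<beta> k = of_real (cos \<alpha> * cos \<beta>) * cis k - of_real (sin \<alpha> * sin \<beta>) * cis (- k)"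

text \<open>As \<open>k\<close> varies, \<open>coin_a\<close> runs through a possibly degenerate
  ellipse with semi-axes \<open>\<bar>s\<bar>\<close> and \<open>\<bar>r\<bar>\<close>. The
  imaginary part determines the gap and thereby the group velocity; the real part enters the weight
  and the decay.\<close>

lemma coin_a_eq: "coin_a \<alpha> \<beta> k = Complex (sin (\<alpha> + \<beta>) * cos k) (sin (\<alpha> - \<beta>) * sin k)"
  by (simp add: coin_a_def complex_eq_iff sin_add sin_diff algebra_simps)

lemma coin_b_eq: "coin_b \<alpha> \<beta> k = Complex (cos (\<alpha> + \<beta>) * cos k) (cos (\<alpha> - \<beta>) * sin k)"
  by (simp add: coin_b_def complex_eq_iff cos_add cos_diff algebra_simps)

lemma coin_ab_norm: "(cmod (coin_a \<alpha> \<beta> k))\<^sup>2 + (cmod (coin_b \<alpha> \<beta> k))\<^sup>2 = 1"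
proof -
  have "(cmod (coin_a \<alpha> \<beta> k))\<^sup>2 + (cmod (coin_b \<alpha> \<beta> k))\<^sup>2
     = ((sin (\<alpha> + \<beta>))\<^sup>2 + (cos (\<alpha> + \<beta>))\<^sup>2) * (cos k)\<^sup>2 + ((sin (\<alpha> - \<beta>))\<^sup>2 + (cos (\<alpha> - \<beta>))\<^sup>2) * (sin k)\<^sup>2"
    by (simp only: coin_a_eq coin_b_eq cmod_power2 complex.sel) (simp only: power_mult_distrib algebra_simps)
  then show ?thesis by simp
qed

text \<open>The coin exchanges horizontal and vertical arcs and the shift preserves each kind, so
  two steps close up on \<open>D0\<close> and \<open>D1\<close>. At the boundary the self-loop
  returns the \<open>D1\<close> output of the coin to the same vertex, which is why site 0 has a
  formula of its own.\<close>

lemma walk_state_Suc: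
  fixes \<alpha> \<beta> n
  defines "\<phi> \<equiv> walk_state \<alpha> \<beta> n"
  defines "P \<equiv> \<lambda>j m. \<phi> ((j, m), D0)" and "Q \<equiv> \<lambda>j m. \<phi> ((j, m), D1)"
  shows "walk_state \<alpha> \<beta> (Suc n) ((0, m), D1) =
      (of_real (cos \<alpha> * cos \<beta>) * P 0 (m + 1) - of_real (sin \<alpha> * sin \<beta>) * P 0 (m - 1))
    - (of_real (cos \<alpha> * sin \<beta>) * Q 0 (m + 1) + of_real (sin \<alpha> * cos \<beta>) * Q 0 (m - 1))"
  and "walk_state \<alpha> \<beta> (Suc n) ((Suc j, m), D1) =
      (of_real (sin \<alpha> * cos \<beta>) * P j (m + 1) + of_real (cos \<alpha> * sin \<beta>) * P j (m - 1))
    + (of_real (cos \<alpha> * cos \<beta>) * Q j (m - 1) - of_real (sin \<alpha> * sin \<beta>) * Q j (m + 1))"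
  and "walk_state \<alpha> \<beta> (Suc n) ((j, m), D0) =
      (of_real (cos \<alpha> * cos \<beta>) * P (Suc j) (m + 1) - of_real (sin \<alpha> * sin \<beta>) * P (Suc j) (m - 1))
    - (of_real (cos \<alpha> * sin \<beta>) * Q (Suc j) (m + 1) + of_real (sin \<alpha> * cos \<beta>) * Q (Suc j) (m - 1))"
proof -
  have step: "walk_state \<alpha> \<beta> (Suc n) = evolution \<alpha> \<beta> (evolution \<alpha> \<beta> \<phi>)"
    by (simp add: walk_state_def \<phi>_def)
  show "walk_state \<alpha> \<beta> (Suc n) ((0, m), D1) =
      (of_real (cos \<alpha> * cos \<beta>) * P 0 (m + 1) - of_real (sin \<alpha> * sin \<beta>) * P 0 (m - 1))
    - (of_real (cos \<alpha> * sin \<beta>) * Q 0 (m + 1) + of_real (sin \<alpha> * cos \<beta>) * Q 0 (m - 1))"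
    "walk_state \<alpha> \<beta> (Suc n) ((Suc j, m), D1) =
      (of_real (sin \<alpha> * cos \<beta>) * P j (m + 1) + of_real (cos \<alpha> * sin \<beta>) * P j (m - 1))
    + (of_real (cos \<alpha> * cos \<beta>) * Q j (m - 1) - of_real (sin \<alpha> * sin \<beta>) * Q j (m + 1))"
    "walk_state \<alpha> \<beta> (Suc n) ((j, m), D0) =
      (of_real (cos \<alpha> * cos \<beta>) * P (Suc j) (m + 1) - of_real (sin \<alpha> * sin \<beta>) * P (Suc j) (m - 1))
    - (of_real (cos \<alpha> * sin \<beta>) * Q (Suc j) (m + 1) + of_real (sin \<alpha> * cos \<beta>) * Q (Suc j) (m - 1))"
    unfolding step evolution_def
    by (simp_all add: Defs.shift_def coin_def UNIV_dir P_def Q_def algebra_simps)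
qed

lemma finite_support_lincomb:
  fixes f g :: "int \<Rightarrow> complex"
  assumes "finite {m. f m \<noteq> 0}" "finite {m. g m \<noteq> 0}"
  shows "finite {m. u * f m + v * g m \<noteq> 0}"
  by (rule finite_subset[of _ "{m. f m \<noteq> 0} \<union> {m. g m \<noteq> 0}"]) (use assms in auto)

lemma hat_lincomb4:
  fixes f g :: "int \<Rightarrow> complex"
  assumes f: "finite {m. f m \<noteq> 0}" and g: "finite {m. g m \<noteq> 0}"
  shows "finite {m. (u * f (m + 1) + v * f (m - 1)) + (x * g (m + 1) + y * g (m - 1)) \<noteq> 0}" (is ?fin)
    and "hat (\<lambda>m. (u * f (m + 1) + v * f (m - 1)) + (x * g (m + 1) + y * g (m - 1))) k
     = (u * cis k + v * cis (- k)) * hat f k + (x * cis k + y * cis (- k)) * hat g k" (is ?hat)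
proof -
  note tr = finite_support_translate[OF f, of 1] finite_support_translate[OF f, of "- 1"]
    finite_support_translate[OF g, of 1] finite_support_translate[OF g, of "- 1"]
  note f1 = finite_support_lincomb[OF tr(1,2), of u v]
  note g1 = finite_support_lincomb[OF tr(3,4), of x y]
  show ?fin
    using finite_support_lincomb[OF f1 g1, of 1 1] by simp
  show ?hat
    using hat_lincomb[OF f1 g1, of 1 1 k] hat_lincomb[OF tr(1,2), of u v k] hat_lincomb[OF tr(3,4), of x y k]
      hat_translate[of f 1 k] hat_translate[of f "- 1" k] hat_translate[of g 1 k] hat_translate[of g "- 1" k]
    by (simp add: algebra_simps)
qed

text \<open>Finiteness of the support runs through the same induction, since linearity of
  \<open>hat\<close> depends on it.\<close>

lemma hat_walk_state:
  shows "finite {m. walk_state \<alpha> \<beta> n ((j, m), D0) \<noteq> 0}"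
    and "finite {m. walk_state \<alpha> \<beta> n ((j, m), D1) \<noteq> 0}"
    and "hat (\<lambda>m. walk_state \<alpha> \<beta> n ((j, m), D0)) k = left_amp (coin_a \<alpha> \<beta> k) (coin_b \<alpha> \<beta> k) n j"
    and "hat (\<lambda>m. walk_state \<alpha> \<beta> n ((j, m), D1)) k = right_amp (coin_a \<alpha> \<beta> k) (coin_b \<alpha> \<beta> k) n j"
proof -
  have "finite {m. walk_state \<alpha> \<beta> n ((j, m), D0) \<noteq> 0} \<and> finite {m. walk_state \<alpha> \<beta> n ((j, m), D1) \<noteq> 0} \<and>
    hat (\<lambda>m. walk_state \<alpha> \<beta> n ((j, m), D0)) k = left_amp (coin_a \<alpha> \<beta> k) (coin_b \<alpha> \<beta> k) n j \<and>
    hat (\<lambda>m. walk_state \<alpha> \<beta> n ((j, m), D1)) k = right_amp (coin_a \<alpha> \<beta> k) (coin_b \<alpha> \<beta> k) n j"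
  proof (induction n arbitrary: j)
    case 0
    have "{m. walk_state \<alpha> \<beta> 0 ((j, m), D1) \<noteq> 0} = (if j = 0 then {0} else {})"
      by (auto simp: walk_state_def kdelta_def)
    moreover have "{m. walk_state \<alpha> \<beta> 0 ((j, m), D0) \<noteq> 0} = {}"
      by (auto simp: walk_state_def kdelta_def)
    ultimately show ?case
      unfolding hat_def by (auto simp: walk_state_def kdelta_def)
  next
    case (Suc n)
    let ?P = "\<lambda>j m. walk_state \<alpha> \<beta> n ((j, m), D0)" and ?Q = "\<lambda>j m. walk_state \<alpha> \<beta> n ((j, m), D1)"
    have P: "finite {m. ?P j m \<noteq> 0}" "hat (?P j) k = left_amp (coin_a \<alpha> \<beta> k) (coin_b \<alpha> \<beta> k) n j"
      and Q: "finite {m. ?Q j m \<noteq> 0}" "hat (?Q j) k = right_amp (coin_a \<alpha> \<beta> k) (coin_b \<alpha> \<beta> k) n j" for j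
      using Suc.IH by auto
    have ca: "cnj (coin_a \<alpha> \<beta> k) = of_real (sin \<alpha> * cos \<beta>) * cis (- k) + of_real (cos \<alpha> * sin \<beta>) * cis k"
      and cb: "cnj (coin_b \<alpha> \<beta> k) = of_real (cos \<alpha> * cos \<beta>) * cis (- k) - of_real (sin \<alpha> * sin \<beta>) * cis k"
      by (simp_all add: coin_a_def coin_b_def cis_cnj)
    note left_fin = hat_lincomb4(1)[OF P(1) Q(1), where u = "of_real (cos \<alpha> * cos \<beta>)" and v = "- of_real (sin \<alpha> * sin \<beta>)" and x = "- of_real (cos \<alpha> * sin \<beta>)" and y = "- of_real (sin \<alpha> * cos \<beta>)"]
    note left_hat = hat_lincomb4(2)[OF P(1) Q(1), where u = "of_real (cos \<alpha> * cos \<beta>)" and v = "- of_real (sin \<alpha> * sin \<beta>)" and x = "- of_real (cos \<alpha> * sin \<beta>)" and y = "- of_real (sin \<alpha> * cos \<beta>)" and k = k]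
    note right_fin = hat_lincomb4(1)[OF P(1) Q(1), where u = "of_real (sin \<alpha> * cos \<beta>)" and v = "of_real (cos \<alpha> * sin \<beta>)" and x = "- of_real (sin \<alpha> * sin \<beta>)" and y = "of_real (cos \<alpha> * cos \<beta>)"]
    note right_hat = hat_lincomb4(2)[OF P(1) Q(1), where u = "of_real (sin \<alpha> * cos \<beta>)" and v = "of_real (cos \<alpha> * sin \<beta>)" and x = "- of_real (sin \<alpha> * sin \<beta>)" and y = "of_real (cos \<alpha> * cos \<beta>)" and k = k]
    have L: "finite {m. walk_state \<alpha> \<beta> (Suc n) ((j, m), D0) \<noteq> 0}"
       "hat (\<lambda>m. walk_state \<alpha> \<beta> (Suc n) ((j, m), D0)) k = left_amp (coin_a \<alpha> \<beta> k) (coin_b \<alpha> \<beta> k) (Suc n) j"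
      using left_fin[of "Suc j" "Suc j"] left_hat[of "Suc j" "Suc j"]
      unfolding walk_state_Suc(3) half_walk.simps snd_conv ca P(2) Q(2)
      by (simp_all add: coin_b_def algebra_simps)
    have R: "finite {m. walk_state \<alpha> \<beta> (Suc n) ((j, m), D1) \<noteq> 0}"
       "hat (\<lambda>m. walk_state \<alpha> \<beta> (Suc n) ((j, m), D1)) k = right_amp (coin_a \<alpha> \<beta> k) (coin_b \<alpha> \<beta> k) (Suc n) j"
    proof -
      have "finite {m. walk_state \<alpha> \<beta> (Suc n) ((j, m), D1) \<noteq> 0} \<and>
       hat (\<lambda>m. walk_state \<alpha> \<beta> (Suc n) ((j, m), D1)) k = right_amp (coin_a \<alpha> \<beta> k) (coin_b \<alpha> \<beta> k) (Suc n) j"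
      proof (cases j)
        case 0
        show ?thesis
          using left_fin[of 0 0] left_hat[of 0 0]
          unfolding 0 walk_state_Suc(1) half_walk.simps fst_conv ca P(2) Q(2)
          by (simp add: coin_b_def algebra_simps)
      next
        case (Suc i)
        show ?thesis
          using right_fin[of i i] right_hat[of i i]
          unfolding Suc walk_state_Suc(2) half_walk.simps fst_conv cb P(2) Q(2)
          by (simp add: coin_a_def algebra_simps)
      qed
      then show "finite {m. walk_state \<alpha> \<beta> (Suc n) ((j, m), D1) \<noteq> 0}"
       "hat (\<lambda>m. walk_state \<alpha> \<beta> (Suc n) ((j, m), D1)) k = right_amp (coin_a \<alpha> \<beta> k) (coin_b \<alpha> \<beta> k) (Suc n) j"
        by auto
    qed
    show ?case using L R by blast
  qed
  then show "finite {m. walk_state \<alpha> \<beta> n ((j, m), D0) \<noteq> 0}"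
    "finite {m. walk_state \<alpha> \<beta> n ((j, m), D1) \<noteq> 0}"
    "hat (\<lambda>m. walk_state \<alpha> \<beta> n ((j, m), D0)) k = left_amp (coin_a \<alpha> \<beta> k) (coin_b \<alpha> \<beta> k) n j"
    "hat (\<lambda>m. walk_state \<alpha> \<beta> n ((j, m), D1)) k = right_amp (coin_a \<alpha> \<beta> k) (coin_b \<alpha> \<beta> k) n j"
    by auto
qed

definition site_state :: "real \<Rightarrow> real \<Rightarrow> nat \<Rightarrow> nat \<Rightarrow> int \<Rightarrow> complex" where
  "site_state \<alpha> \<beta> n k m = walk_state \<alpha> \<beta> n ((k div 2, m), if even k then D1 else D0)"

lemma nu_eq: "nu \<alpha> \<beta> n k m = (cmod (site_state \<alpha> \<beta> n k m))\<^sup>2"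
  by (simp add: nu_def site_state_def)

lemma finite_site_state: "finite {m. site_state \<alpha> \<beta> n k m \<noteq> 0}"
  using hat_walk_state(1,2)[of \<alpha> \<beta> n "k div 2"] by (auto simp: site_state_def)

lemma hat_site_state: "hat (site_state \<alpha> \<beta> n j) k = site_amp (coin_a \<alpha> \<beta> k) (coin_b \<alpha> \<beta> k) n j"
proof -
  have "site_state \<alpha> \<beta> n j = (\<lambda>m. walk_state \<alpha> \<beta> n ((j div 2, m), if even j then D1 else D0))"
    by (simp add: site_state_def fun_eq_iff)
  then show ?thesis
    using hat_walk_state(3,4)[of \<alpha> \<beta> n "j div 2" k] by (simp add: site_amp_def)
qed

section \<open>The limit of the characteristic functions\<close>

lemma integral_cis_int:
  "integral {-pi..pi} (\<lambda>k. cis (k * of_int m)) = (if m = 0 then of_real (2 * pi) else 0)"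
proof (cases "m = 0")
  case False
  have "((\<lambda>k. cis (k * of_int m)) has_integral
      cis (pi * of_int m) / (\<i> * of_int m) - cis (- pi * of_int m) / (\<i> * of_int m)) {-pi..pi}"
    using False
    by (intro fundamental_theorem_of_calculus)
       (auto simp: cis_conv_exp intro!: derivative_eq_intros has_vector_derivative_real_field simp: mult.commute[of _ \<i>])
  moreover have "cis (pi * of_int m) = cis (- pi * of_int m)"
    by (simp add: complex_eq_iff)
  ultimately show ?thesis using False by (simp add: integral_unique)
qed (simp add: scaleR_conv_of_real)

lemma continuous_on_hat: "continuous_on S (hat f)"
  unfolding hat_def[abs_def] cis_conv_exp by (intro continuous_intros)

text \<open>Parseval with a shift: moving the momentum by \<open>t\<close> multiplies
  \<open>f m\<close> by \<open>cis (t * m)\<close>, so the correlation is the unnormalised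
  characteristic function of the squared modulus of \<open>f\<close>.\<close>

lemma integral_cnj_hat_hat:
  assumes "finite {m. f m \<noteq> 0}"
  shows "integral {-pi..pi} (\<lambda>k. cnj (hat f k) * hat f (k - t))
    = of_real (2 * pi) * (\<Sum>m | f m \<noteq> 0. of_real ((cmod (f m))\<^sup>2) * iexp (t * of_int m))"
proof -
  let ?A = "{m. f m \<noteq> 0}"
  have int: "(\<lambda>k. c * cis (k * of_int m)) integrable_on {-pi..pi}" for c and m :: int
    unfolding cis_conv_exp by (intro integrable_continuous_interval continuous_intros)
  have "cnj (hat f k) * hat f (k - t)
     = (\<Sum>m\<in>?A. \<Sum>m'\<in>?A. cnj (f m) * f m' * cis (t * of_int m') * cis (k * of_int (m - m')))" for k
  proof -
    have *: "cnj (f m * cis (- k * of_int m)) * (f m' * cis (- (k - t) * of_int m'))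
        = cnj (f m) * f m' * (cis (t * of_int m') * cis (k * of_int (m - m')))" for m m'
    proof -
      have "cis (k * of_int m) * cis (- (k - t) * of_int m') = cis (t * of_int m') * cis (k * of_int (m - m'))"
        unfolding cis_mult by (simp add: algebra_simps)
      then show ?thesis by (simp add: cis_cnj mult.left_commute mult.assoc)
    qed
    show ?thesis unfolding hat_def cnj_sum sum_product * by (simp only: mult.assoc)
  qed
  then have "integral {-pi..pi} (\<lambda>k. cnj (hat f k) * hat f (k - t))
    = integral {-pi..pi} (\<lambda>k. \<Sum>m\<in>?A. \<Sum>m'\<in>?A. cnj (f m) * f m' * cis (t * of_int m') * cis (k * of_int (m - m')))"
    by simp
  also have "\<dots> = (\<Sum>m\<in>?A. integral {-pi..pi} (\<lambda>k. \<Sum>m'\<in>?A. cnj (f m) * f m' * cis (t * of_int m') * cis (k * of_int (m - m'))))"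
    by (intro integral_sum integrable_sum int assms)
  also have "\<dots> = (\<Sum>m\<in>?A. \<Sum>m'\<in>?A. integral {-pi..pi} (\<lambda>k. cnj (f m) * f m' * cis (t * of_int m') * cis (k * of_int (m - m'))))"
    by (intro sum.cong refl integral_sum int assms)
  also have "\<dots> = (\<Sum>m\<in>?A. \<Sum>m'\<in>?A. if m = m' then cnj (f m) * f m' * cis (t * of_int m') * of_real (2 * pi) else 0)"
    by (intro sum.cong refl) (simp only: integral_mult_right integral_cis_int, simp)
  also have "\<dots> = (\<Sum>m\<in>?A. cnj (f m) * f m * cis (t * of_int m) * of_real (2 * pi))"
    using assms by (simp add: sum.delta)
  also have "\<dots> = of_real (2 * pi) * (\<Sum>m\<in>?A. of_real ((cmod (f m))\<^sup>2) * iexp (t * of_int m))"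
    unfolding sum_distrib_left
    by (intro sum.cong refl) (simp add: complex_norm_square cis_conv_exp mult_ac del: of_real_power)
  finally show ?thesis .
qed

section \<open>Dispersion, group velocity and squared modulus of the bound state\<close>

definition wdisp :: "real \<Rightarrow> real \<Rightarrow> real" where
  "wdisp r k = sqrt (1 - (r * sin k)\<^sup>2)"

text \<open>Minus the derivative of the phase of the bound eigenvalue, which is
  \<open>sgn (s * cos k) * r * cos k / wdisp r k\<close>. The two signs of \<open>cos k\<close>
  combine into a modulus, so the velocity never has the sign opposite to \<open>s * r\<close>; hence
  the one-sided factor \<open>chi\<close> in the limit.\<close>

definition velocity :: "real \<Rightarrow> real \<Rightarrow> real \<Rightarrow> real" where
  "velocity s r k = sgn (s * r) * \<bar>r * cos k\<bar> / wdisp r k"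

text \<open>The squared modulus of \<open>bound_site\<close> along the curve of coin parameters; the
  ratio becomes \<open>zeta\<close> after the substitution by the velocity.\<close>

definition profile :: "real \<Rightarrow> real \<Rightarrow> nat \<Rightarrow> real \<Rightarrow> real" where
  "profile s r e k = (s * cos k / wdisp r k)\<^sup>2 * ((wdisp r k - \<bar>s * cos k\<bar>) / (wdisp r k + \<bar>s * cos k\<bar>)) ^ e"

lemma abs_r_sin_less: "\<bar>r\<bar> < 1 \<Longrightarrow> \<bar>r * sin k\<bar> < 1" for r :: real
  using mult_left_le[of "\<bar>sin k\<bar>" "\<bar>r\<bar>"] by (auto simp: abs_mult intro: order.strict_trans1)

lemma wdisp_pos: "\<bar>r\<bar> < 1 \<Longrightarrow> wdisp r k > 0"
  using abs_r_sin_less[of r k] by (simp add: wdisp_def abs_square_less_1)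

lemma wdisp_square: "\<bar>r\<bar> < 1 \<Longrightarrow> (wdisp r k)\<^sup>2 = 1 - (r * sin k)\<^sup>2"
  using abs_r_sin_less[of r k] by (simp add: wdisp_def abs_square_le_1)

text \<open>Polar form of the eigenvalue. The sign prefactor has no limit by itself, but it cancels
  against its conjugate at a nearby momentum with the same sign of the real part.\<close>

lemma bound_eigenvalue_power:
  assumes r: "\<bar>r\<bar> < 1" and c: "c \<noteq> 0"
  shows "bound_eigenvalue (Complex c (r * sin k)) ^ n
    = (- of_real (sgn c)) ^ n * cis (- sgn c * (real n * arcsin (r * sin k)))"
proof -
  have "bound_eigenvalue (Complex c (r * sin k)) = - of_real (sgn c) * cis (- sgn c * arcsin (r * sin k))"
    using abs_r_sin_less[OF r, of k] c
    by (cases "c > 0") (auto simp: bound_eigenvalue_def gap_def complex_eq_iff cos_arcsin)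
  then have "bound_eigenvalue (Complex c (r * sin k)) ^ n
     = (- of_real (sgn c)) ^ n * cis (- sgn c * arcsin (r * sin k)) ^ n"
    by (simp only: power_mult_distrib)
  also have "cis (- sgn c * arcsin (r * sin k)) ^ n = cis (- sgn c * (real n * arcsin (r * sin k)))"
    unfolding Complex.DeMoivre by (rule arg_cong[of _ _ cis]) simp
  finally show ?thesis .
qed

lemma arcsin_difference_limit:
  assumes r: "\<bar>r\<bar> < 1"
  shows "(\<lambda>n. real n * (arcsin (r * sin (k - t / real n)) - arcsin (r * sin k)))
     \<longlonglongrightarrow> - (t * (r * cos k / wdisp r k))"
proof (cases "t = 0")
  case False
  have d: "((\<lambda>k. arcsin (r * sin k)) has_real_derivative (r * cos k / wdisp r k)) (at k)"
    using abs_r_sin_less[OF r, of k]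
    by (auto intro!: derivative_eq_intros simp: wdisp_def field_simps)
  \<comment> \<open>The increment has to avoid 0 itself, hence the separate case
    \<open>t = 0\<close>.\<close>
  have lim: "filterlim (\<lambda>n. - t / real n) (at 0) sequentially"
    unfolding filterlim_at using False lim_const_over_n[of "- t"]
    by (auto intro: eventually_mono[OF eventually_gt_at_top[of 0]])
  from d have "((\<lambda>h. (arcsin (r * sin (k + h)) - arcsin (r * sin k)) / h) \<longlongrightarrow> r * cos k / wdisp r k) (at 0)"
    by (simp add: DERIV_def)
  from tendsto_mult[OF tendsto_const[of "- t"] filterlim_compose[OF this lim]]
  have "(\<lambda>n. - t * ((arcsin (r * sin (k + - t / real n)) - arcsin (r * sin k)) / (- t / real n)))
     \<longlonglongrightarrow> - t * (r * cos k / wdisp r k)" by simp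
  then show ?thesis using False by (simp add: mult_ac)
qed simp

lemma eigenvalue_phase_limit:
  assumes r: "\<bar>r\<bar> < 1" and c: "s * cos k \<noteq> 0"
  defines "a \<equiv> \<lambda>k. Complex (s * cos k) (r * sin k)"
  shows "(\<lambda>n. cnj (bound_eigenvalue (a k) ^ n) * bound_eigenvalue (a (k - t / real n)) ^ n)
     \<longlonglongrightarrow> iexp (t * velocity s r k)"
proof -
  define \<epsilon> where "\<epsilon> = sgn (s * cos k)"
  have \<epsilon>: "\<epsilon> = 1 \<or> \<epsilon> = -1" using c by (auto simp: \<epsilon>_def sgn_if)
  have kn: "(\<lambda>n. k - t / real n) \<longlonglongrightarrow> k"
    using tendsto_diff[OF tendsto_const lim_const_over_n[of t]] by simp
  \<comment> \<open>The sign of \<open>s * cos\<close> is locally constant away from its zeros, so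
    both momenta eventually share \<open>\<epsilon>\<close> and the sign prefactors multiply to
    1.\<close>
  have "(\<lambda>n. s * cos (k - t / real n) * \<epsilon>) \<longlonglongrightarrow> s * cos k * \<epsilon>"
    by (intro tendsto_intros kn)
  moreover have "s * cos k * \<epsilon> > 0"
    unfolding \<epsilon>_def using c linorder_less_linear[of "s * cos k" 0] by (auto simp: sgn_if)
  ultimately have "\<forall>\<^sub>F n in sequentially. s * cos (k - t / real n) * \<epsilon> > 0"
    by (rule order_tendstoD)
  then have ev: "\<forall>\<^sub>F n in sequentially.
     cis (- \<epsilon> * (real n * (arcsin (r * sin (k - t / real n)) - arcsin (r * sin k))))
     = cnj (bound_eigenvalue (a k) ^ n) * bound_eigenvalue (a (k - t / real n)) ^ n"
  proof eventually_elim
    case (elim n)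
    have sg: "sgn (s * cos (k - t / real n)) = \<epsilon>" and nz: "s * cos (k - t / real n) \<noteq> 0"
      using elim \<epsilon> by (auto simp: sgn_if)
    have "(complex_of_real \<epsilon>) * of_real \<epsilon> = 1" using \<epsilon> by auto
    then have "cnj ((- of_real \<epsilon>) ^ n) * (- of_real \<epsilon>) ^ n = (1 :: complex)"
      by (simp flip: power_mult_distrib)
    then show ?case
      unfolding a_def bound_eigenvalue_power[OF r c] bound_eigenvalue_power[OF r nz] sg \<epsilon>_def[symmetric]
      by (simp add: cis_cnj cis_mult algebra_simps)
  qed
  have "(\<lambda>n. cis (- \<epsilon> * (real n * (arcsin (r * sin (k - t / real n)) - arcsin (r * sin k)))))
     \<longlonglongrightarrow> cis (- \<epsilon> * - (t * (r * cos k / wdisp r k)))"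
    unfolding cis_conv_exp by (intro tendsto_intros arcsin_difference_limit r)
  also have "- \<epsilon> * - (t * (r * cos k / wdisp r k)) = t * velocity s r k"
    using c by (auto simp: \<epsilon>_def velocity_def sgn_if abs_if zero_less_mult_iff mult_less_0_iff)
  finally show ?thesis
    unfolding cis_conv_exp[of "t * velocity s r k", symmetric]
    by (rule Lim_transform_eventually[OF _ ev])
qed

text \<open>Unitarity gives \<open>norm b ^ 2 = gap a ^ 2 - (Re a) ^ 2\<close>, which factors; one
  factor cancels against the square of \<open>bound_decay a\<close>.\<close>

lemma cmod_bound_site:
  assumes ab: "(cmod a)\<^sup>2 + (cmod b)\<^sup>2 = 1" and b: "b \<noteq> 0" and a: "Re a \<noteq> 0"
  shows "(cmod (bound_site a b j))\<^sup>2
    = (Re a / gap a)\<^sup>2 * ((gap a - \<bar>Re a\<bar>) / (gap a + \<bar>Re a\<bar>)) ^ site_exponent j"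
proof -
  have g: "gap a \<ge> 0" and g2: "(gap a)\<^sup>2 = (Re a)\<^sup>2 + (cmod b)\<^sup>2"
  proof -
    have *: "1 - (Im a)\<^sup>2 = (Re a)\<^sup>2 + (cmod b)\<^sup>2" using ab by (simp add: cmod_power2)
    show "gap a \<ge> 0" "(gap a)\<^sup>2 = (Re a)\<^sup>2 + (cmod b)\<^sup>2" unfolding gap_def * by auto
  qed
  have b2: "(cmod b)\<^sup>2 = (gap a - \<bar>Re a\<bar>) * (gap a + \<bar>Re a\<bar>)"
    using g2 by (simp add: algebra_simps power2_eq_square)
  have "(bound_decay a)\<^sup>2 = (gap a - \<bar>Re a\<bar>)\<^sup>2"
    using a by (auto simp: bound_decay_def sgn_if abs_if power2_commute add.commute)
  then have "(bound_decay a)\<^sup>2 / (cmod b)\<^sup>2 = (gap a - \<bar>Re a\<bar>) / (gap a + \<bar>Re a\<bar>)"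
  proof -
    assume *: "(bound_decay a)\<^sup>2 = (gap a - \<bar>Re a\<bar>)\<^sup>2"
    have "gap a - \<bar>Re a\<bar> \<noteq> 0" using b b2 by auto
    then show ?thesis unfolding * b2 by (simp add: power2_eq_square)
  qed
  moreover have "(cmod (bound_site a b j))\<^sup>2 = (Re a / gap a)\<^sup>2 * ((bound_decay a)\<^sup>2 / (cmod b)\<^sup>2) ^ site_exponent j"
  proof -
    have "cmod (bound_site a b j) = \<bar>Re a\<bar> / gap a * (\<bar>bound_decay a\<bar> / cmod b) ^ site_exponent j"
      using g by (simp add: bound_site_def bound_weight_def norm_mult norm_power norm_divide)
    moreover have "(x ^ e)\<^sup>2 = (x\<^sup>2) ^ e" for x :: real and e
      by (metis power_mult mult.commute)
    ultimately show ?thesis by (simp only: power_mult_distrib power_divide power2_abs)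
  qed
  ultimately show ?thesis by simp
qed

lemma site_correlation_limit:
  fixes \<alpha> \<beta> k t :: real and j :: nat
  defines "s \<equiv> sin (\<alpha> + \<beta>)" and "r \<equiv> sin (\<alpha> - \<beta>)"
  defines "F \<equiv> \<lambda>n k. site_amp (coin_a \<alpha> \<beta> k) (coin_b \<alpha> \<beta> k) n j"
  assumes r: "\<bar>r\<bar> < 1" and s: "s \<noteq> 0" and k: "sin k \<noteq> 0" "cos k \<noteq> 0"
  shows "(\<lambda>n. cnj (F n k) * F n (k - t / real n))
    \<longlonglongrightarrow> of_real (profile s r (site_exponent j) k) * iexp (t * velocity s r k)"
proof -
  let ?a = "coin_a \<alpha> \<beta>" and ?b = "coin_b \<alpha> \<beta>"
  have a: "?a = (\<lambda>k. Complex (s * cos k) (r * sin k))" by (simp add: fun_eq_iff coin_a_eq s_def r_def)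
  note ab = coin_ab_norm[of \<alpha> \<beta>]
  define kn where "kn n = k - t / real n" for n :: nat
  have kn: "kn \<longlonglongrightarrow> k"
    unfolding kn_def using tendsto_diff[OF tendsto_const lim_const_over_n[of t]] by simp
  have la: "(\<lambda>n. ?a (kn n)) \<longlonglongrightarrow> ?a k" and lb: "(\<lambda>n. ?b (kn n)) \<longlonglongrightarrow> ?b k"
    unfolding coin_a_def coin_b_def cis_conv_exp by (intro tendsto_intros kn)+
  have c: "s * cos k \<noteq> 0" using s k by simp
  have Re: "Re (?a k) \<noteq> 0" using c by (simp add: a)
  have gap_a: "gap (?a k) = wdisp r k" for k by (simp add: gap_def a wdisp_def)
  have gap0: "gap (?a k) \<noteq> 0" using wdisp_pos[OF r, of k] by (simp add: gap_a)
  \<comment> \<open>The imaginary part \<open>cos (\<alpha> - \<beta>) * sin k\<close> is nonzero,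
    since \<open>\<bar>r\<bar> < 1\<close> excludes
    \<open>cos (\<alpha> - \<beta>) = 0\<close>.\<close>
  have b0: "?b k \<noteq> 0"
  proof
    assume "?b k = 0"
    then have "cos (\<alpha> - \<beta>) * sin k = 0" by (simp add: coin_b_eq complex_eq_iff)
    then have "cos (\<alpha> - \<beta>) = 0" using k by simp
    then have "r\<^sup>2 = 1" using sin_cos_squared_add[of "\<alpha> - \<beta>"] by (simp add: r_def)
    then show False using r by (simp add: power2_eq_1_iff) auto
  qed
  let ?g = "\<lambda>k. bound_site (?a k) (?b k) j" and ?l = "\<lambda>k. bound_eigenvalue (?a k)"
  have X: "(\<lambda>n. F n k - ?g k * ?l k ^ n) \<longlonglongrightarrow> 0"
    unfolding F_def by (rule site_amp_limit[OF ab tendsto_const tendsto_const Re b0 gap0])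
  have Y: "(\<lambda>n. F n (kn n) - ?g (kn n) * ?l (kn n) ^ n) \<longlonglongrightarrow> 0"
    unfolding F_def by (rule site_amp_limit[OF ab la lb Re b0 gap0])
  have g: "(\<lambda>n. ?g (kn n)) \<longlonglongrightarrow> ?g k"
    unfolding bound_site_def bound_weight_def bound_decay_def
    using la lb Re b0 gap0 by (intro tendsto_intros) (auto simp: gap_def intro!: tendsto_intros la)
  have nl: "norm (?l k ^ n) = 1" for n
    using c bound_eigenvalue_power[OF r c, of k n] by (simp add: a norm_mult norm_power sgn_if)
  have F1: "norm (F n k) \<le> 1" for n k unfolding F_def by (rule site_amp_le[OF ab])
  \<comment> \<open>The product is split into three terms. Each of the first two contains one
    approximation error times a bounded factor; the third is the pure bound-state
    contribution.\<close>
  have 1: "(\<lambda>n. cnj (F n k - ?g k * ?l k ^ n) * F n (kn n)) \<longlonglongrightarrow> 0"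
  proof (rule Lim_null_comparison[OF _ tendsto_norm_zero[OF X]], intro always_eventually allI)
    fix n
    show "norm (cnj (F n k - ?g k * ?l k ^ n) * F n (kn n)) \<le> norm (F n k - ?g k * ?l k ^ n)"
      unfolding norm_mult complex_mod_cnj using F1 by (intro mult_left_le) auto
  qed
  have 2: "(\<lambda>n. cnj (?g k * ?l k ^ n) * (F n (kn n) - ?g (kn n) * ?l (kn n) ^ n)) \<longlonglongrightarrow> 0"
  proof (rule Lim_null_comparison[OF _ tendsto_mult_right_zero[OF tendsto_norm_zero[OF Y], of "norm (?g k)"]],
      intro always_eventually allI)
    fix n
    show "norm (cnj (?g k * ?l k ^ n) * (F n (kn n) - ?g (kn n) * ?l (kn n) ^ n))
      \<le> norm (?g k) * norm (F n (kn n) - ?g (kn n) * ?l (kn n) ^ n)"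
      unfolding norm_mult complex_mod_cnj nl by simp
  qed
  have 3: "(\<lambda>n. (cnj (?g k) * ?g (kn n)) * (cnj (?l k ^ n) * ?l (kn n) ^ n))
     \<longlonglongrightarrow> (cnj (?g k) * ?g k) * iexp (t * velocity s r k)"
    unfolding kn_def using g eigenvalue_phase_limit[OF r c, of t]
    by (intro tendsto_intros) (simp_all add: a kn_def)
  have "cnj (?g k) * ?g k = of_real (profile s r (site_exponent j) k)"
    using cmod_bound_site[OF ab b0 Re, of j] complex_norm_square[of "?g k"]
    by (simp add: gap_a profile_def mult.commute) (simp add: a)
  moreover have "cnj (F n k - ?g k * ?l k ^ n) * F n (kn n)
      + cnj (?g k * ?l k ^ n) * (F n (kn n) - ?g (kn n) * ?l (kn n) ^ n)
      + (cnj (?g k) * ?g (kn n)) * (cnj (?l k ^ n) * ?l (kn n) ^ n) = cnj (F n k) * F n (kn n)" for n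
    by (simp add: algebra_simps)
  ultimately show ?thesis
    using tendsto_add[OF tendsto_add[OF 1 2] 3] by (simp only: add_0 kn_def)
qed

lemma continuous_on_wdisp: "continuous_on S (wdisp r)"
  unfolding wdisp_def[abs_def] by (intro continuous_intros)

lemma continuous_on_velocity:
  assumes "\<bar>r\<bar> < 1"
  shows "continuous_on S (velocity s r)"
  unfolding velocity_def[abs_def]
  by (intro continuous_intros continuous_on_wdisp) (metis wdisp_pos[OF assms] less_irrefl)

lemma continuous_on_profile:
  assumes "\<bar>r\<bar> < 1"
  shows "continuous_on S (profile s r e)"
proof -
  have "wdisp r k \<noteq> 0" "wdisp r k + \<bar>s * cos k\<bar> \<noteq> 0" for k
    using wdisp_pos[OF assms, of k] by auto
  then show ?thesis
    unfolding profile_def[abs_def] by (intro continuous_intros continuous_on_wdisp) auto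
qed

lemma site_char_limit:
  fixes \<alpha> \<beta> t :: real
  defines "s \<equiv> sin (\<alpha> + \<beta>)" and "r \<equiv> sin (\<alpha> - \<beta>)"
  assumes r: "\<bar>r\<bar> < 1" and s: "s \<noteq> 0"
  shows "(\<lambda>n. \<Sum>m | site_state \<alpha> \<beta> n j m \<noteq> 0.
        of_real ((cmod (site_state \<alpha> \<beta> n j m))\<^sup>2) * iexp (t * (of_int m / real n)))
    \<longlonglongrightarrow> integral {-pi..pi} (\<lambda>k. of_real (profile s r (site_exponent j) k) * iexp (t * velocity s r k)) / of_real (2 * pi)"
proof -
  define F where "F = (\<lambda>n k. site_amp (coin_a \<alpha> \<beta> k) (coin_b \<alpha> \<beta> k) n j)"
  have F: "F n = hat (site_state \<alpha> \<beta> n j)" for n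
    by (simp add: fun_eq_iff F_def hat_site_state)
  have F1: "norm (F n k) \<le> 1" for n k unfolding F_def by (rule site_amp_le[OF coin_ab_norm])
  let ?f = "\<lambda>n k. cnj (F n k) * F n (k - t / real n)"
  let ?h = "\<lambda>k. of_real (profile s r (site_exponent j) k) * iexp (t * velocity s r k) :: complex"
  have cont: "continuous_on UNIV (?f n)" for n
    unfolding F by (intro continuous_intros continuous_on_hat continuous_on_compose2[OF continuous_on_hat[of UNIV]]) auto
  have conth: "continuous_on UNIV ?h"
    by (intro continuous_intros continuous_on_velocity continuous_on_profile r)
  have conv: "(LINT k:{-pi..pi}|lborel. u k) = integral {-pi..pi} u" if "continuous_on UNIV u" for u :: "real \<Rightarrow> complex"
    by (rule set_borel_integral_eq_integral, rule borel_integrable_atLeastAtMost')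
       (use that continuous_on_subset in blast)
  have "(\<lambda>n. LINT k:{-pi..pi}|lborel. ?f n k) \<longlonglongrightarrow> (LINT k:{-pi..pi}|lborel. ?h k)"
    unfolding set_lebesgue_integral_def
  proof (rule integral_dominated_convergence[where w = "\<lambda>k. indicator {-pi..pi} k"])
    show "(\<lambda>k. indicator {-pi..pi} k *\<^sub>R ?h k) \<in> borel_measurable lborel"
      using borel_measurable_continuous_onI[OF conth] by measurable
    show "(\<lambda>k. indicator {-pi..pi} k *\<^sub>R ?f n k) \<in> borel_measurable lborel" for n
      using borel_measurable_continuous_onI[OF cont[of n]] by measurable
    show "integrable lborel (\<lambda>k. indicator {-pi..pi} k :: real)" by simp
    show "AE k in lborel. norm (indicator {-pi..pi} k *\<^sub>R ?f n k) \<le> indicator {-pi..pi} k" for n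
      using F1 by (auto simp: norm_mult indicator_def intro!: mult_le_one)
    \<comment> \<open>All zeros of \<open>sin\<close> and \<open>cos\<close> lie in this countable
      set; elsewhere the correlation converges.\<close>
    let ?Z = "range (\<lambda>i::int. of_int i * (pi / 2))"
    have "AE k in lborel. k \<notin> ?Z"
      by (intro AE_not_in countable_imp_null_set_lborel) auto
    then show "AE k in lborel. (\<lambda>n. indicator {-pi..pi} k *\<^sub>R ?f n k) \<longlonglongrightarrow> indicator {-pi..pi} k *\<^sub>R ?h k"
    proof eventually_elim
      case (elim k)
      have "sin k \<noteq> 0"
      proof
        assume "sin k = 0"
        then obtain i :: int where "k = of_int i * pi" by (auto simp: sin_zero_iff_int2)
        then have "k = of_int (2 * i) * (pi / 2)" by simp
        with elim show False by blast
      qed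
      moreover have "cos k \<noteq> 0"
      proof
        assume "cos k = 0"
        then obtain i :: int where "k = of_int i * (pi / 2)" by (auto simp: cos_zero_iff_int)
        with elim show False by blast
      qed
      ultimately show ?case
        using site_correlation_limit[of \<alpha> \<beta> k j t] r s
        unfolding s_def r_def F_def by (intro tendsto_scaleR tendsto_const)
    qed
  qed
  then have "(\<lambda>n. integral {-pi..pi} (?f n)) \<longlonglongrightarrow> integral {-pi..pi} ?h"
    unfolding conv[OF cont] conv[OF conth] .
  then have "(\<lambda>n. integral {-pi..pi} (?f n) / of_real (2 * pi)) \<longlonglongrightarrow> integral {-pi..pi} ?h / of_real (2 * pi)"
    by (intro tendsto_intros) auto
  then show ?thesis
    unfolding F integral_cnj_hat_hat[OF finite_site_state] by simp
qed

section \<open>From characteristic functions to intervals\<close>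

lemma finite_scaled_ints:
  assumes "n > 0"
  shows "finite {m :: int. a < real_of_int m / real n \<and> real_of_int m / real n < b}"
proof (rule finite_subset)
  show "{m :: int. a < real_of_int m / real n \<and> real_of_int m / real n < b} \<subseteq> {\<lfloor>a * real n\<rfloor>..\<lceil>b * real n\<rceil>}"
    using assms by (auto simp: field_simps) linarith+
qed simp

text \<open>Levy's theorem needs probability measures, so the masses are normalised; a vanishing total
  limit mass has to be treated separately.\<close>

lemma char_limit_imp_interval_limit:
  fixes p :: "nat \<Rightarrow> int \<Rightarrow> real" and G :: "real \<Rightarrow> real"
  assumes fin: "\<And>n. finite {m. p n m \<noteq> 0}" and p0: "\<And>n m. 0 \<le> p n m"
    and G0: "\<And>y. 0 \<le> G y" and G: "integrable lborel G"
    and conv: "\<And>t. (\<lambda>n. \<Sum>m | p n m \<noteq> 0. of_real (p n m) * iexp (t * (of_int m / real n)))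
      \<longlonglongrightarrow> (CLINT y|lborel. of_real (G y) * iexp (t * y))"
  shows "(\<lambda>n. \<Sum>m | a < real_of_int m / real n \<and> real_of_int m / real n < b. p n m)
    \<longlonglongrightarrow> (LBINT y:{a..b}. G y)"
proof -
  define A where "A n = {m. p n m \<noteq> 0}" for n
  define C where "C n = (\<Sum>m\<in>A n. p n m)" for n
  define D where "D = (LINT y|lborel. G y)"
  have finA: "finite (A n)" for n using fin by (simp add: A_def)
  have Gm [measurable]: "G \<in> borel_measurable borel" using G by auto
  \<comment> \<open>At \<open>t = 0\<close> the convergence hypothesis is convergence of the total
    masses.\<close>
  have C: "C \<longlonglongrightarrow> D"
    using tendsto_Re[OF conv[of 0]] by (simp add: C_def[abs_def] A_def D_def)
  have D0: "0 \<le> D" unfolding D_def using G0 by (intro Bochner_Integration.integral_nonneg) auto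
  have C0: "0 \<le> C n" for n unfolding C_def using p0 by (intro sum_nonneg) auto
  let ?I = "\<lambda>n. {m :: int. a < real_of_int m / real n \<and> real_of_int m / real n < b}"
  \<comment> \<open>For \<open>n = 0\<close> every quotient \<open>m / n\<close> is 0 and the index
    set need not be finite, so positivity of \<open>n\<close> is essential.\<close>
  have restrict: "(\<Sum>m\<in>?I n. p n m) = (\<Sum>m\<in>A n \<inter> ?I n. p n m)" if "n > 0" for n
    using finite_scaled_ints[OF that, of a b] by (intro sum.mono_neutral_right) (auto simp: A_def)
  show ?thesis
  proof (cases "D = 0")
    case True
    have "(LBINT y:{a..b}. G y) \<le> D"
      unfolding D_def set_lebesgue_integral_def using G0 G
      by (intro Bochner_Integration.integral_mono integrable_mult_indicator) (auto simp: indicator_def)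
    moreover have "0 \<le> (LBINT y:{a..b}. G y)"
      unfolding set_lebesgue_integral_def using G0 by (intro Bochner_Integration.integral_nonneg) auto
    ultimately have "(LBINT y:{a..b}. G y) = 0" using True by simp
    moreover have "(\<lambda>n. \<Sum>m\<in>?I n. p n m) \<longlonglongrightarrow> 0"
    proof (rule tendsto_sandwich[OF _ _ tendsto_const])
      show "\<forall>\<^sub>F n in sequentially. 0 \<le> (\<Sum>m\<in>?I n. p n m)"
        using p0 by (intro always_eventually allI sum_nonneg) auto
      show "\<forall>\<^sub>F n in sequentially. (\<Sum>m\<in>?I n. p n m) \<le> C n"
        using eventually_gt_at_top[of 0]
      proof eventually_elim
        case (elim n)
        show ?case unfolding restrict[OF elim] C_def using p0 finA by (intro sum_mono2) auto
      qed
      show "C \<longlonglongrightarrow> 0" using C True by simp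
    qed
    ultimately show ?thesis by simp
  next
    case False
    then have Dp: "D > 0" using D0 by simp
    define M where "M = density lborel (\<lambda>y. ennreal (G y / D))"
    define P where "P n = point_measure (A n) (\<lambda>m. p n m / C n)" for n
    \<comment> \<open>Levy's theorem demands a probability measure for every index. Where the mass
      is 0 the limit \<open>M\<close> serves as a filler; as the masses tend to
      \<open>D > 0\<close>, this happens only finitely often.\<close>
    define N where "N n = (if C n > 0 then distr (P n) borel (\<lambda>m. real_of_int m / real n) else M)" for n
    have "emeasure M UNIV = ennreal (LINT y|lborel. G y / D)"
    proof -
      have "emeasure M UNIV = (\<integral>\<^sup>+y. ennreal (G y / D) \<partial>lborel)"
        unfolding M_def by (subst emeasure_density) auto
      also have "\<dots> = ennreal (LINT y|lborel. G y / D)"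
        using G G0 D0 by (intro nn_integral_eq_integral) auto
      finally show ?thesis .
    qed
    also have "(LINT y|lborel. G y / D) = 1" using Dp by (simp add: D_def)
    finally have "prob_space M" by (intro prob_spaceI) (simp add: M_def)
    then have M: "real_distribution M"
      by (intro real_distribution.intro real_distribution_axioms.intro) (auto simp: M_def)
    have sP: "space (P n) = A n" "sets (P n) = Pow (A n)" for n
      by (auto simp: P_def space_point_measure sets_point_measure)
    have prob_P: "prob_space (P n)" if "C n > 0" for n
    proof (rule prob_spaceI)
      have "emeasure (P n) (A n) = ennreal (\<Sum>m\<in>A n. p n m / C n)"
        unfolding P_def using finA p0 that by (subst emeasure_point_measure_finite) auto
      also have "(\<Sum>m\<in>A n. p n m / C n) = 1"
        using that by (simp add: C_def flip: sum_divide_distrib)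
      finally show "emeasure (P n) (space (P n)) = 1" by (simp add: sP)
    qed
    have meas [measurable]: "(\<lambda>m. real_of_int m / real n) \<in> P n \<rightarrow>\<^sub>M borel" for n
      by (rule measurableI) (auto simp: sP)
    have N: "real_distribution (N n)" for n
      unfolding N_def using prob_space.real_distribution_distr[OF prob_P meas] M by auto
    have charM: "char M t = (CLINT y|lborel. of_real (G y) * iexp (t * y)) / of_real D" for t
    proof -
      have "char M t = (CLINT y|lborel. (G y / D) *\<^sub>R iexp (t * y))"
        unfolding char_def M_def using G0 D0 by (intro integral_density) auto
      also have "\<dots> = (CLINT y|lborel. (of_real (G y) * iexp (t * y)) / of_real D)"
        by (simp add: scaleR_conv_of_real)
      finally show ?thesis by simp
    qed
    have charN: "char (N n) t = (\<Sum>m\<in>A n. of_real (p n m) * iexp (t * (of_int m / real n))) / of_real (C n)"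
      if "C n > 0" for n t
    proof -
      have "char (N n) t = (CLINT m|P n. iexp (t * (real_of_int m / real n)))"
        unfolding char_def N_def using that by (simp add: integral_distr)
      also have "\<dots> = (\<Sum>m\<in>A n. (p n m / C n) *\<^sub>R iexp (t * (real_of_int m / real n)))"
        unfolding P_def using finA p0 that by (intro lebesgue_integral_point_measure_finite) auto
      finally show ?thesis by (simp add: scaleR_conv_of_real sum_divide_distrib)
    qed
    have ev: "\<forall>\<^sub>F n in sequentially. C n > 0 \<and> n > 0"
      using order_tendstoD(1)[OF C Dp] eventually_gt_at_top[of 0] by (rule eventually_conj)
    have "weak_conv_m N M"
    proof (rule levy_continuity[OF N M])
      fix t
      have "(\<lambda>n. (\<Sum>m\<in>A n. of_real (p n m) * iexp (t * (of_int m / real n))) / of_real (C n)) \<longlonglongrightarrow> char M t"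
        unfolding charM using conv[of t] Dp C by (intro tendsto_intros) (auto simp: A_def)
      then show "(\<lambda>n. char (N n) t) \<longlonglongrightarrow> char M t"
        by (rule Lim_transform_eventually) (rule eventually_mono[OF ev], simp add: charN)
    qed
    \<comment> \<open>\<open>M\<close> has a density, so the endpoints are null and the open
      interval is a continuity set.\<close>
    have conv_N: "(\<lambda>n. measure (N n) {a<..<b}) \<longlonglongrightarrow> measure M {a<..<b}"
    proof (rule weak_conv_imp_continuity_set_conv[OF N M \<open>weak_conv_m N M\<close>])
      have "frontier {a<..<b} \<subseteq> {a, b}"
      proof -
        have "closure {a<..<b} \<subseteq> {a..b}" by (rule closure_minimal) auto
        then show ?thesis unfolding frontier_def interior_open[OF open_greaterThanLessThan] by force
      qed
      then have "countable (frontier {a<..<b})" by (rule countable_subset) simp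
      then have "frontier {a<..<b} \<in> null_sets lborel" by (rule countable_imp_null_set_lborel)
      then have "(\<integral>\<^sup>+y\<in>frontier {a<..<b}. ennreal (G y / D) \<partial>lborel) = 0"
        by (rule nn_integral_null_set)
      moreover have "emeasure M (frontier {a<..<b}) = (\<integral>\<^sup>+y\<in>frontier {a<..<b}. ennreal (G y / D) \<partial>lborel)"
        unfolding M_def by (rule emeasure_density) (auto simp: frontier_closed intro: borel_closed)
      ultimately show "emeasure M (frontier {a<..<b}) = 0" by simp
      show "{a<..<b} \<in> sets borel" by simp
    qed
    have "measure M {a<..<b} = (LBINT y:{a..b}. G y) / D"
    proof -
      have "emeasure M {a<..<b} = (\<integral>\<^sup>+y. ennreal (G y / D * indicator {a<..<b} y) \<partial>lborel)"
        unfolding M_def using D0 G0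
        by (subst emeasure_density) (auto intro!: nn_integral_cong simp: indicator_def)
      also have "\<dots> = ennreal (LINT y|lborel. G y / D * indicator {a<..<b} y)"
        using G0 D0 G by (intro nn_integral_eq_integral)
          (auto intro!: integrable_real_mult_indicator)
      also have "(LINT y|lborel. G y / D * indicator {a<..<b} y) = (LINT y:{a<..<b}|lborel. G y) / D"
        unfolding set_lebesgue_integral_def
        by (subst integral_divide_zero[symmetric]) (auto intro!: Bochner_Integration.integral_cong)
      also have "(LINT y:{a<..<b}|lborel. G y) = (LINT y:{a..b}|lborel. G y)"
        by (rule set_integral_discrete_difference[where X = "{a, b}"]) auto
      finally show ?thesis
        unfolding measure_def using D0 G0
        by (simp only:) (intro enn2real_ennreal divide_nonneg_nonneg, auto simp: set_lebesgue_integral_def intro!: Bochner_Integration.integral_nonneg)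
    qed
    then have "(\<lambda>n. C n * measure (N n) {a<..<b}) \<longlonglongrightarrow> (LBINT y:{a..b}. G y)"
      using tendsto_mult[OF C conv_N] Dp by simp
    then show ?thesis
    proof (rule Lim_transform_eventually)
      show "\<forall>\<^sub>F n in sequentially. C n * measure (N n) {a<..<b} = (\<Sum>m\<in>?I n. p n m)"
        using ev
      proof eventually_elim
        case (elim n)
        have "measure (N n) {a<..<b} = measure (P n) (A n \<inter> ?I n)"
        proof -
          have "measure (N n) {a<..<b} = measure (P n) ((\<lambda>m. real_of_int m / real n) -` {a<..<b} \<inter> space (P n))"
            unfolding N_def using elim by (simp only: if_True) (rule measure_distr[OF meas], simp)
          also have "(\<lambda>m. real_of_int m / real n) -` {a<..<b} \<inter> space (P n) = A n \<inter> ?I n"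
            unfolding sP by auto
          finally show ?thesis .
        qed
        also have "\<dots> = (\<Sum>m\<in>A n \<inter> ?I n. p n m / C n)"
          unfolding P_def using finA p0 elim by (subst measure_point_measure_finite_if) auto
        also have "\<dots> = (\<Sum>m\<in>?I n. p n m) / C n"
          using elim restrict by (simp only: sum_divide_distrib)
        finally show ?case using elim by simp
      qed
    qed
  qed
qed

section \<open>Substitution of the group velocity\<close>

text \<open>The velocity takes each interior value on four branches over a full period. Evenness and
  reflection at \<open>pi / 2\<close> reduce the integral to one branch, where a change of variables
  is possible.\<close>

lemma integral_quarter_period:
  fixes u :: "real \<Rightarrow> complex"
  assumes u: "continuous_on UNIV u" and even: "\<And>k. u (- k) = u k" and sym: "\<And>k. u (pi - k) = u k"
  shows "integral {-pi..pi} u = 4 * integral {0..pi/2} u"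
proof -
  have int: "u integrable_on {a..b}" for a b
    by (rule integrable_continuous_interval[OF continuous_on_subset[OF u]]) simp
  have neg: "integral {-pi..0} u = integral {0..pi} u"
    using Henstock_Kurzweil_Integration.integral_reflect_real[where f = u and a = 0 and b = pi] by (simp add: even)
  have "u (x + pi) = u x" for x using sym[of "- x"] even[of x] by (simp add: add.commute)
  then have "integral {-pi..-(pi/2)} u = integral {0..pi/2} u"
    using integral_shift_real_ivl[where a = 0 and c = pi and b = "pi/2" and f = u] by simp
  moreover have "integral {-pi..-(pi/2)} u = integral {pi/2..pi} u"
    using Henstock_Kurzweil_Integration.integral_reflect_real[where f = u and a = "pi/2" and b = pi] by (simp add: even)
  ultimately have "integral {0..pi} u = 2 * integral {0..pi/2} u"
    using Henstock_Kurzweil_Integration.integral_combine[of 0 "pi/2" pi u] int by simp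
  then show ?thesis
    using Henstock_Kurzweil_Integration.integral_combine[of "-pi" 0 pi u] int neg by simp
qed

section \<open>Sign and measurability of the limit density\<close>

lemma zeta_nonneg: "\<bar>s * y\<bar> < \<bar>r\<bar> \<Longrightarrow> 0 \<le> zeta s r y" for s r y :: real
  by (simp add: zeta_def abs_mult)

lemma limit_density_nonneg:
  assumes r: "\<bar>r\<bar> < 1" and s: "\<bar>s\<bar> \<le> 1"
  shows "0 \<le> limit_density s r j y"
proof (cases "\<bar>y\<bar> < \<bar>r\<bar>")
  case True
  have "\<bar>s * y\<bar> < \<bar>r\<bar>"
    using True mult_right_mono[OF s, of "\<bar>y\<bar>"] by (simp add: abs_mult)
  then have "0 \<le> zeta s r y" by (rule zeta_nonneg)
  moreover have "0 \<le> konno_density y \<bar>r\<bar>"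
  proof -
    have yr: "y\<^sup>2 \<le> r\<^sup>2"
      using power_mono[of "\<bar>y\<bar>" "\<bar>r\<bar>" 2] True unfolding power2_abs by simp
    have r1: "r\<^sup>2 \<le> 1"
      using r by (simp add: abs_square_le_1)
    from yr r1 have "0 \<le> 1 - r\<^sup>2" "0 \<le> 1 - y\<^sup>2" "0 \<le> r\<^sup>2 - y\<^sup>2" by linarith+
    then show ?thesis
      unfolding konno_density_def power2_abs
      by (intro mult_nonneg_nonneg divide_nonneg_nonneg) auto
  qed
  moreover have "0 \<le> chi s r y" by (simp add: chi_def)
  ultimately show ?thesis
  proof -
    assume *: "0 \<le> zeta s r y" "0 \<le> konno_density y \<bar>r\<bar>" "0 \<le> chi s r y"
    have "0 \<le> 2 * s\<^sup>2 / r\<^sup>2 * y\<^sup>2" by simp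
    from mult_nonneg_nonneg[OF mult_nonneg_nonneg[OF mult_nonneg_nonneg[OF this *(2)] zero_le_power[OF *(1)]] *(3)]
    show ?thesis unfolding limit_density_def .
  qed
next
  case False
  then have "y \<notin> {- \<bar>r\<bar><..<\<bar>r\<bar>}" unfolding greaterThanLessThan_iff by linarith
  then have "konno_density y \<bar>r\<bar> = 0" by (simp add: konno_density_def)
  then show ?thesis by (simp add: limit_density_def)
qed

lemma borel_measurable_limit_density: "limit_density s r j \<in> borel_measurable borel"
proof -
  have "chi s r \<in> borel_measurable borel" unfolding chi_def by auto
  then show ?thesis
    unfolding limit_density_def[abs_def] zeta_def konno_density_def by measurable
qed

text \<open>The modulus around \<open>cos k\<close> is dropped: the result is differentiable
  everywhere and agrees with \<open>velocity\<close> on the quarter period, where the cosine is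
  positive.\<close>

definition branch_velocity :: "real \<Rightarrow> real \<Rightarrow> real \<Rightarrow> real" where
  "branch_velocity s r k = sgn (s * r) * \<bar>r\<bar> * (cos k / wdisp r k)"

definition branch_deriv :: "real \<Rightarrow> real \<Rightarrow> real \<Rightarrow> real" where
  "branch_deriv s r k = - (sgn (s * r) * \<bar>r\<bar> * sin k * (1 - r\<^sup>2) / wdisp r k ^ 3)"

lemma wdisp_cos: "\<bar>r\<bar> < 1 \<Longrightarrow> (wdisp r k)\<^sup>2 = 1 - r\<^sup>2 + r\<^sup>2 * (cos k)\<^sup>2"
  by (simp add: wdisp_square power_mult_distrib sin_squared_eq algebra_simps)

lemma branch_velocity_deriv:
  assumes r: "\<bar>r\<bar> < 1"
  shows "(branch_velocity s r has_field_derivative branch_deriv s r k) (at k within S)"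
proof -
  have w: "wdisp r k > 0" by (rule wdisp_pos[OF r])
  have pos: "0 < 1 - (r * sin k)\<^sup>2" using w by (simp add: wdisp_def)
  have dw: "(wdisp r has_field_derivative (- (r\<^sup>2 * sin k * cos k) / wdisp r k)) (at k within S)"
  proof -
    have "((\<lambda>k. 1 - (r * sin k)\<^sup>2) has_field_derivative - (2 * (r\<^sup>2 * sin k * cos k))) (at k within S)"
      by (auto intro!: derivative_eq_intros simp: power2_eq_square)
    then have "((\<lambda>k. sqrt (1 - (r * sin k)\<^sup>2)) has_field_derivative
        inverse (sqrt (1 - (r * sin k)\<^sup>2)) / 2 * - (2 * (r\<^sup>2 * sin k * cos k))) (at k within S)"
      by (rule DERIV_chain2[where f = sqrt and g = "\<lambda>k. 1 - (r * sin k)\<^sup>2" and x = k and s = S, OF DERIV_real_sqrt[OF pos]])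
    moreover have "inverse S / 2 * - (2 * P) = - P / S" for S P :: real
      by (cases "S = 0") (simp_all add: field_simps)
    ultimately show ?thesis unfolding wdisp_def by (simp only:)
  qed
  have "((\<lambda>k. cos k / wdisp r k) has_field_derivative
      (- sin k * wdisp r k - cos k * (- (r\<^sup>2 * sin k * cos k) / wdisp r k)) / (wdisp r k * wdisp r k)) (at k within S)"
    by (rule DERIV_divide[OF has_field_derivative_at_within[OF DERIV_cos] dw]) (use w in simp)
  \<comment> \<open>The quotient rule simplifies because
    \<open>wdisp r k ^ 2 - r ^ 2 * cos k ^ 2\<close> is the constant
    \<open>1 - r ^ 2\<close>.\<close>
  moreover have "(- sin k * wdisp r k - cos k * (- (r\<^sup>2 * sin k * cos k) / wdisp r k)) / (wdisp r k * wdisp r k)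
      = - (sin k * (1 - r\<^sup>2) / wdisp r k ^ 3)"
  proof -
    have "- sin k * wdisp r k - cos k * (- (r\<^sup>2 * sin k * cos k) / wdisp r k)
        = (- sin k * ((wdisp r k)\<^sup>2 - r\<^sup>2 * (cos k)\<^sup>2)) / wdisp r k"
      using w by (simp add: field_simps power2_eq_square)
    also have "\<dots> = - (sin k * (1 - r\<^sup>2)) / wdisp r k" by (simp add: wdisp_cos[OF r])
    finally show ?thesis using w by (simp add: power3_eq_cube)
  qed
  ultimately have "((\<lambda>k. cos k / wdisp r k) has_field_derivative - (sin k * (1 - r\<^sup>2) / wdisp r k ^ 3)) (at k within S)"
    by (simp only:)
  from DERIV_cmult[OF this, of "sgn (s * r) * \<bar>r\<bar>"] show ?thesis
    unfolding branch_velocity_def[abs_def] branch_deriv_def by (rule DERIV_cong) simp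
qed

text \<open>With \<open>w = wdisp r k\<close> one has \<open>1 - y ^ 2 = (1 - r ^ 2) / w ^ 2\<close>
  and \<open>r ^ 2 - y ^ 2 = r ^ 2 * sin k ^ 2 * (1 - r ^ 2) / w ^ 2\<close>. Hence the Jacobian
  times the Konno density is exactly \<open>1 / pi\<close>. The factor
  \<open>2 * s ^ 2 / r ^ 2 * y ^ 2\<close> is twice the weight in \<open>profile\<close>, and
  \<open>zeta\<close> is its ratio.\<close>

lemma branch_density:
  assumes r: "0 < \<bar>r\<bar>" "\<bar>r\<bar> < 1" and s: "s \<noteq> 0" and k: "k \<in> {0<..<pi/2}"
  shows "\<bar>branch_deriv s r k\<bar> * limit_density s r j (branch_velocity s r k)
    = 2 / pi * profile s r (site_exponent j) k"
proof -
  define w c q where "w = wdisp r k" and "c = cos k" and "q = sqrt (1 - r\<^sup>2)"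
  have w: "w > 0" unfolding w_def by (rule wdisp_pos[OF r(2)])
  have c: "c > 0" and sn: "sin k > 0" using k by (auto simp: c_def cos_gt_zero sin_gt_zero)
  have r2: "1 - r\<^sup>2 > 0" using r by (simp add: abs_square_less_1)
  have q: "q > 0" "q\<^sup>2 = 1 - r\<^sup>2" using r2 by (auto simp: q_def)
  have q': "sqrt (1 - \<bar>r\<bar>\<^sup>2) = q" by (simp add: q_def)
  have w2: "w\<^sup>2 = 1 - r\<^sup>2 + r\<^sup>2 * c\<^sup>2" unfolding w_def c_def by (rule wdisp_cos[OF r(2)])
  have sc: "(sin k)\<^sup>2 = 1 - c\<^sup>2" by (simp add: c_def sin_squared_eq)
  define y where "y = branch_velocity s r k"
  have sgn: "sgn (s * r) = 1 \<or> sgn (s * r) = -1" using r s by (auto simp: sgn_if)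
  have y: "y = sgn (s * r) * (\<bar>r\<bar> * c / w)" by (simp add: y_def branch_velocity_def w_def c_def)
  have ay: "\<bar>y\<bar> = \<bar>r\<bar> * c / w" using sgn w c by (auto simp: y abs_mult)
  have "\<bar>y\<bar>\<^sup>2 = (\<bar>r\<bar> * c / w)\<^sup>2" unfolding ay ..
  then have y2: "y\<^sup>2 = r\<^sup>2 * c\<^sup>2 / w\<^sup>2" by (simp add: power_mult_distrib power_divide)
  have 1: "1 - y\<^sup>2 = q\<^sup>2 / w\<^sup>2"
    unfolding y2 q(2) using w w2 by (simp add: field_simps)
  have "\<bar>r\<bar>\<^sup>2 - y\<^sup>2 = r\<^sup>2 * (w\<^sup>2 - c\<^sup>2) / w\<^sup>2" unfolding y2 using w by (simp add: field_simps)
  also have "w\<^sup>2 - c\<^sup>2 = (sin k * q)\<^sup>2" unfolding power_mult_distrib sc q(2) w2 by (simp add: algebra_simps)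
  finally have 2: "\<bar>r\<bar>\<^sup>2 - y\<^sup>2 = (\<bar>r\<bar> * sin k * q / w)\<^sup>2" by (simp add: power_mult_distrib power_divide)
  have sq: "sqrt (\<bar>r\<bar>\<^sup>2 - y\<^sup>2) = \<bar>r\<bar> * sin k * q / w"
    unfolding 2 using sn q w by (simp add: abs_mult)
  have "y\<^sup>2 < \<bar>r\<bar>\<^sup>2" using 2 r sn q w by (metis diff_gt_0_iff_gt divide_pos_pos mult_pos_pos zero_less_power)
  then have "\<bar>y\<bar> < \<bar>r\<bar>" using power2_less_imp_less[of "\<bar>y\<bar>" "\<bar>r\<bar>"] by simp
  then have "y \<in> {- \<bar>r\<bar><..<\<bar>r\<bar>}" unfolding greaterThanLessThan_iff by linarith
  then have "indicator {- \<bar>r\<bar><..<\<bar>r\<bar>} y = (1::real)" by simp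
  then have konno: "konno_density y \<bar>r\<bar> = w ^ 3 / (pi * q\<^sup>2 * (\<bar>r\<bar> * sin k))"
    unfolding konno_density_def sq 1 q' using q(1) w r sn
    by (simp add: field_simps power2_eq_square power3_eq_cube)
  have zt: "zeta s r y = (w - \<bar>s * c\<bar>) / (w + \<bar>s * c\<bar>)"
  proof -
    have "zeta s r y = (\<bar>r\<bar> * (w - \<bar>s * c\<bar>) / w) / (\<bar>r\<bar> * (w + \<bar>s * c\<bar>) / w)"
      unfolding zeta_def ay using w c by (simp add: field_simps abs_mult)
    then show ?thesis using w r by simp
  qed
  have chi: "chi s r y = 1"
    unfolding y chi_def using w c r s sgn
    by (auto simp: sgn_if mult_nonneg_nonneg divide_nonneg_nonneg)
  have der: "\<bar>branch_deriv s r k\<bar> = \<bar>r\<bar> * sin k * q\<^sup>2 / w ^ 3"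
    unfolding branch_deriv_def w_def[symmetric] q(2) using sgn sn r2 w by (auto simp: abs_mult)
  have "\<bar>branch_deriv s r k\<bar> * konno_density y \<bar>r\<bar> = 1 / pi"
    unfolding der konno using w q r sn by (simp add: field_simps)
  then have "\<bar>branch_deriv s r k\<bar> * limit_density s r j y
     = 2 * s\<^sup>2 / r\<^sup>2 * y\<^sup>2 * (1 / pi) * zeta s r y ^ site_exponent j"
  proof -
    assume *: "\<bar>branch_deriv s r k\<bar> * konno_density y \<bar>r\<bar> = 1 / pi"
    have "\<bar>branch_deriv s r k\<bar> * limit_density s r j y
      = 2 * s\<^sup>2 / r\<^sup>2 * y\<^sup>2 * (\<bar>branch_deriv s r k\<bar> * konno_density y \<bar>r\<bar>) * zeta s r y ^ site_exponent j"
      unfolding limit_density_def chi site_exponent_def by (simp only: mult_ac mult_1_right)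
    then show ?thesis unfolding * .
  qed
  also have "2 * s\<^sup>2 / r\<^sup>2 * y\<^sup>2 = 2 * (s * c / w)\<^sup>2"
    unfolding y2 using r w by (simp add: power_mult_distrib power_divide)
  finally show ?thesis
    unfolding profile_def zt y_def[symmetric] w_def[symmetric] c_def[symmetric] by simp
qed

lemma branch_velocity_inj:
  assumes r: "0 < \<bar>r\<bar>" "\<bar>r\<bar> < 1" and s: "s \<noteq> 0"
  shows "inj_on (branch_velocity s r) {0<..<pi/2}"
proof (rule inj_onI)
  fix k l assume k: "k \<in> {0<..<pi/2}" and l: "l \<in> {0<..<pi/2}" and eq: "branch_velocity s r k = branch_velocity s r l"
  have w: "wdisp r k > 0" "wdisp r l > 0" using wdisp_pos[OF r(2)] by auto
  have c: "cos k > 0" "cos l > 0" using k l by (auto simp: cos_gt_zero)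
  have "sgn (s * r) * \<bar>r\<bar> \<noteq> 0" using r s by (auto simp: sgn_if)
  from iffD1[OF mult_left_cancel[OF this] eq[unfolded branch_velocity_def]]
  have "cos k / wdisp r k = cos l / wdisp r l" .
  then have "cos k * wdisp r l = cos l * wdisp r k" using w by (simp add: field_simps)
  from arg_cong[OF this, of "\<lambda>x. x\<^sup>2"]
  have "(cos k)\<^sup>2 * (wdisp r l)\<^sup>2 = (cos l)\<^sup>2 * (wdisp r k)\<^sup>2"
    by (simp only: power_mult_distrib)
  then have "(1 - r\<^sup>2) * (cos k)\<^sup>2 = (1 - r\<^sup>2) * (cos l)\<^sup>2"
    unfolding wdisp_cos[OF r(2)] by (simp add: algebra_simps)
  moreover have "1 - r\<^sup>2 \<noteq> 0" using r by (auto simp: power2_eq_1_iff)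
  ultimately have "(cos k)\<^sup>2 = (cos l)\<^sup>2" by simp
  then have "cos k = cos l" using c by (simp add: power2_eq_iff)
  then show "k = l" by (rule cos_inj_pi[rotated -1]) (use k l in auto)
qed

text \<open>The image of the open quarter period contains the whole support of the density. The
  intermediate value theorem gives a point of the closed interval; its ends are excluded because the
  factor \<open>y ^ 2\<close> kills \<open>y = 0\<close> and the open indicator kills
  \<open>\<bar>y\<bar> = \<bar>r\<bar>\<close>.\<close>

lemma branch_velocity_image:
  assumes r: "0 < \<bar>r\<bar>" "\<bar>r\<bar> < 1" and s: "s \<noteq> 0" and y: "limit_density s r j y \<noteq> 0"
  shows "y \<in> branch_velocity s r ` {0<..<pi/2}"
proof -
  have y0: "y \<noteq> 0" "\<bar>y\<bar> < \<bar>r\<bar>" and sy: "y = sgn (s * r) * \<bar>y\<bar>"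
  proof -
    show "y \<noteq> 0" using y by (auto simp: limit_density_def)
    have "konno_density y \<bar>r\<bar> \<noteq> 0" using y by (auto simp: limit_density_def)
    then have "indicator {- \<bar>r\<bar><..<\<bar>r\<bar>} y \<noteq> (0::real)" unfolding konno_density_def by fastforce
    then show "\<bar>y\<bar> < \<bar>r\<bar>" by (auto simp: indicator_def split: if_splits)
    have "chi s r y \<noteq> 0" using y by (auto simp: limit_density_def)
    then show "y = sgn (s * r) * \<bar>y\<bar>"
      using r s by (auto simp: chi_def indicator_def sgn_if split: if_splits)
  qed
  let ?h = "\<lambda>k. \<bar>r\<bar> * cos k / wdisp r k"
  have "\<exists>k\<ge>0. k \<le> pi/2 \<and> ?h k = \<bar>y\<bar>"
  proof (rule IVT2')
    show "?h (pi/2) \<le> \<bar>y\<bar>" "\<bar>y\<bar> \<le> ?h 0" using y0 by (auto simp: wdisp_def)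
    show "continuous_on {0..pi/2} ?h"
      using wdisp_pos[OF r(2)] by (intro continuous_intros continuous_on_wdisp) (metis less_irrefl)
  qed auto
  then obtain k where k: "0 \<le> k" "k \<le> pi/2" "?h k = \<bar>y\<bar>" by blast
  have "k \<noteq> 0" using k(3) y0 by (auto simp: wdisp_def)
  moreover have "k \<noteq> pi/2"
  proof
    assume "k = pi/2"
    then have "cos k = 0" using cos_pi_half by (simp only:)
    then show False using k(3) y0 by simp
  qed
  ultimately have "k \<in> {0<..<pi/2}" using k by simp
  moreover have "branch_velocity s r k = y"
  proof -
    have "branch_velocity s r k = sgn (s * r) * (\<bar>r\<bar> * cos k / wdisp r k)"
      by (simp add: branch_velocity_def)
    then show ?thesis unfolding k(3) sy[symmetric] .
  qed
  ultimately show ?thesis by blast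
qed

text \<open>A general test function serves two purposes: the constant 1 yields integrability of the
  density, the exponential yields its characteristic function.\<close>

lemma limit_density_integral:
  fixes \<phi> :: "real \<Rightarrow> complex"
  assumes r: "0 < \<bar>r\<bar>" "\<bar>r\<bar> < 1" and s: "s \<noteq> 0" and \<phi>: "continuous_on UNIV \<phi>"
  shows "integrable lborel (\<lambda>y. limit_density s r j y *\<^sub>R \<phi> y)"
    and "(CLINT y|lborel. limit_density s r j y *\<^sub>R \<phi> y)
      = integral {-pi..pi} (\<lambda>k. of_real (profile s r (site_exponent j) k) * \<phi> (velocity s r k)) / of_real (2 * pi)"
proof -
  define u where "u k = of_real (profile s r (site_exponent j) k) * \<phi> (velocity s r k)" for k
  define f where "f y = limit_density s r j y *\<^sub>R \<phi> y" for y
  let ?S = "{0<..<pi/2}"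
  have u: "continuous_on UNIV u"
    unfolding u_def
    by (intro continuous_intros continuous_on_profile continuous_on_compose2[OF \<phi>] continuous_on_velocity r) auto
  have u_int: "integral {-pi..pi} u = 4 * integral {0..pi/2} u"
    by (rule integral_quarter_period[OF u]) (auto simp: u_def profile_def velocity_def wdisp_def)
  have f_eq: "\<bar>branch_deriv s r k\<bar> *\<^sub>R f (branch_velocity s r k) = (2 / pi) *\<^sub>R u k" if k: "k \<in> ?S" for k
  proof -
    have "velocity s r k = branch_velocity s r k"
      using k by (simp add: velocity_def branch_velocity_def abs_mult cos_gt_zero less_imp_le)
    then show ?thesis
      unfolding f_def u_def scaleR_scaleR branch_density[OF r s k] by (simp add: scaleR_conv_of_real)
  qed
  have "(\<lambda>k. (2 / pi) *\<^sub>R u k) absolutely_integrable_on ?S"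
  proof (rule set_integrable_subset)
    show "(\<lambda>k. (2 / pi) *\<^sub>R u k) absolutely_integrable_on {0..pi/2}"
      by (intro absolutely_integrable_continuous_real continuous_intros continuous_on_subset[OF u]) auto
  qed auto
  then have ai: "(\<lambda>k. \<bar>branch_deriv s r k\<bar> *\<^sub>R f (branch_velocity s r k)) absolutely_integrable_on ?S"
    by (rule set_integrable_cong[THEN iffD1, rotated -1]) (auto simp: f_eq)
  have "integral ?S (\<lambda>k. \<bar>branch_deriv s r k\<bar> *\<^sub>R f (branch_velocity s r k)) = integral ?S (\<lambda>k. (2 / pi) *\<^sub>R u k)"
    by (rule Henstock_Kurzweil_Integration.integral_cong) (rule f_eq)
  also have "\<dots> = (2 / pi) *\<^sub>R integral {0..pi/2} u"
    by (simp add: integral_open_interval_real[symmetric])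
  finally have f: "f absolutely_integrable_on branch_velocity s r ` ?S"
     "integral (branch_velocity s r ` ?S) f = (2 / pi) *\<^sub>R integral {0..pi/2} u"
    using has_absolute_integral_change_of_variables_real[of ?S "branch_velocity s r" "branch_deriv s r" f
       "(2 / pi) *\<^sub>R integral {0..pi/2} u"] ai
      branch_velocity_deriv[OF r(2)] branch_velocity_inj[OF r s] by auto
  \<comment> \<open>Off the image the density vanishes, so the change of variables already covers
    the whole line.\<close>
  have "(\<lambda>y. indicator (branch_velocity s r ` ?S) y *\<^sub>R f y) = f"
    using branch_velocity_image[OF r s, of j] by (auto simp: fun_eq_iff f_def indicator_def)
  then have leb: "integrable lebesgue f" "integral\<^sup>L lebesgue f = (2 / pi) *\<^sub>R integral {0..pi/2} u"
    using f set_lebesgue_integral_eq_integral(2)[OF f(1)]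
    by (simp_all add: set_integrable_def set_lebesgue_integral_def)
  \<comment> \<open>The change of variables lives on the completed measure; Borel measurability
    brings the integral back to \<open>lborel\<close>.\<close>
  have meas: "f \<in> borel_measurable lborel"
    using borel_measurable_limit_density[of s r j] borel_measurable_continuous_onI[OF \<phi>]
    unfolding f_def by measurable
  show "integrable lborel (\<lambda>y. limit_density s r j y *\<^sub>R \<phi> y)"
    using leb(1) integrable_completion[OF meas] unfolding f_def by simp
  have "integral\<^sup>L lborel f = (2 / pi) *\<^sub>R integral {0..pi/2} u"
    using leb(2) integral_completion[OF meas] by simp
  \<comment> \<open>Four quarter periods over the normalisation \<open>2 * pi\<close> account for
    the factor \<open>2 / pi\<close> of the density.\<close>
  also have "\<dots> = integral {-pi..pi} u / of_real (2 * pi)"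
    unfolding u_int by (simp add: scaleR_conv_of_real)
  finally show "(CLINT y|lborel. limit_density s r j y *\<^sub>R \<phi> y)
      = integral {-pi..pi} (\<lambda>k. of_real (profile s r (site_exponent j) k) * \<phi> (velocity s r k)) / of_real (2 * pi)"
    unfolding f_def u_def .
qed

theorem theorem4:
  fixes \<alpha> \<beta> s r a b :: real and j :: nat
  assumes "\<alpha> \<in> {0..<2 * pi}" and "\<beta> \<in> {0..<2 * pi}"
    and "s = sin (\<alpha> + \<beta>)" and "r = sin (\<alpha> - \<beta>)"
    and "0 < \<bar>r\<bar>" and "\<bar>r\<bar> < 1" and "s \<noteq> 0"
    and "a < b"
  shows "(\<lambda>n. \<Sum>m | a < real_of_int m / real n \<and> real_of_int m / real n < b. nu \<alpha> \<beta> n j m)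
           \<longlonglongrightarrow> (LBINT y:{a..b}. limit_density s r j y)"
proof (rule char_limit_imp_interval_limit)
  note r = assms(5,6) and s = assms(7)
  show "finite {m. nu \<alpha> \<beta> n j m \<noteq> 0}" for n
    using finite_site_state[of \<alpha> \<beta> n j] by (simp add: nu_eq)
  show "0 \<le> nu \<alpha> \<beta> n j m" for n m by (simp add: nu_eq)
  show "0 \<le> limit_density s r j y" for y
    using r(2) by (rule limit_density_nonneg) (simp add: assms(3))
  \<comment> \<open>The test function is the complex constant 1; the real part recovers the density
    itself.\<close>
  have "integrable lborel (\<lambda>y. Re (limit_density s r j y *\<^sub>R 1))"
    using limit_density_integral(1)[OF r s continuous_on_const[of UNIV 1]] by (rule integrable_Re)
  then show "integrable lborel (limit_density s r j)" by simp
  fix t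
  have "(CLINT y|lborel. of_real (limit_density s r j y) * iexp (t * y))
     = integral {-pi..pi} (\<lambda>k. of_real (profile s r (site_exponent j) k) * iexp (t * velocity s r k)) / of_real (2 * pi)"
    using limit_density_integral(2)[OF r s, of "\<lambda>y. iexp (t * y)" j]
    by (simp add: scaleR_conv_of_real continuous_intros)
  then show "(\<lambda>n. \<Sum>m | nu \<alpha> \<beta> n j m \<noteq> 0. of_real (nu \<alpha> \<beta> n j m) * iexp (t * (of_int m / real n)))
     \<longlonglongrightarrow> (CLINT y|lborel. of_real (limit_density s r j y) * iexp (t * y))"
    using site_char_limit[of \<alpha> \<beta> j t] r s unfolding assms(3,4) by (simp add: nu_eq)
qed

end
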